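(* For every $q,q'\in\mathcal{N}K[t^{\pm1}]$ and every $\epsilon>0$ there exist $r,r'\in\mathcal{N}K[t^{\pm1}]$ such that $\mathrm{null}\,r<\mathrm{null}\,q'+\epsilon$, $\mathrm{null}\,r'<\mathrm{null}\,q+\mathrm{null}\,q'+\epsilon$, and $qr=q'r'$.
   Context: $G$ is a countable group with an epimorphism $\phi\colon G\to\mathbb{Z}$, $K=\ker\phi$, and $t\in G$ is such that $\phi(t)$ generates $\mathbb{Z}$. $\mathcal{N}K$ is the group von Neumann algebra of $K$: the algebra of bounded operators $\ell^2K\to\ell^2K$ equivariant for the right multiplication action of $K$. $\dim_{\mathcal{N}K}$ is the von Neumann dimension, defined in particular for closed $K$-invariant subspaces of $\ell^2K$. $\mathcal{N}K[t^{\pm1}]$ is the twisted Laurent polynomial ring, with $t$ acting on $\mathcal{N}K$ by the conjugation action (inside $\mathcal{N}G$). For a non-zero $x=\sum_{i\ge k}t^ix_i$ with $x_i\in\mathcal{N}K$ and $x_k\ne0$, the initial term is $\mathrm{init}\,x=t^kx_k$ and its pure part is $x_k$; the pure part of $\mathrm{init}\,0=0$ is $0$. The nullity $\mathrm{null}\,x$ is the $\mathcal{N}K$-dimension of the kernel (in $\ell^2K$) of the pure part of $\mathrm{init}\,x$. *)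

theory Defs
  imports "HOL-Analysis.Analysis" "HOL-Algebra.Algebra"
begin

text \<open>
  Square-summable families on a set \<open>A\<close> are represented by functions on the whole type that
  vanish outside \<open>A\<close>. For \<open>A \<subseteq> B\<close> this makes the extension-by-zero embedding of
  \<open>\<ell>\<^sup>2A\<close> into \<open>\<ell>\<^sup>2B\<close> a literal inclusion of sets.
\<close>

type_synonym 'a vec = "'a \<Rightarrow> complex"
type_synonym 'a vec_op = "'a vec \<Rightarrow> 'a vec"

definition ell2 :: "'a set \<Rightarrow> 'a vec set" where
  "ell2 A = {f. (\<forall>x. x \<notin> A \<longrightarrow> f x = 0) \<and> (\<lambda>x. (cmod (f x))\<^sup>2) summable_on A}"

definition ell2_inner :: "'a set \<Rightarrow> 'a vec \<Rightarrow> 'a vec \<Rightarrow> complex" where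
  "ell2_inner A f g = (\<Sum>\<^sub>\<infinity>x\<in>A. f x * cnj (g x))"

definition ell2_norm :: "'a set \<Rightarrow> 'a vec \<Rightarrow> real" where
  "ell2_norm A f = sqrt (\<Sum>\<^sub>\<infinity>x\<in>A. (cmod (f x))\<^sup>2)"

definition ell2_delta :: "'a \<Rightarrow> 'a vec" where
  "ell2_delta a = (\<lambda>x. if x = a then 1 else 0)"

text \<open>
  Operators are normalised to be \<open>0\<close> outside \<open>\<ell>\<^sup>2A\<close>, so that equality, pointwise sum and
  composition of functions are those of operators on \<open>\<ell>\<^sup>2A\<close>.
\<close>

definition ell2_bounded_op :: "'a set \<Rightarrow> 'a vec_op \<Rightarrow> bool" where
  "ell2_bounded_op A T \<longleftrightarrow>
     (\<forall>f\<in>ell2 A. T f \<in> ell2 A) \<and>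
     (\<forall>f\<in>ell2 A. \<forall>g\<in>ell2 A. \<forall>a b. T (\<lambda>x. a * f x + b * g x) = (\<lambda>x. a * T f x + b * T g x)) \<and>
     (\<exists>C. \<forall>f\<in>ell2 A. ell2_norm A (T f) \<le> C * ell2_norm A f) \<and>
     (\<forall>f. f \<notin> ell2 A \<longrightarrow> T f = (\<lambda>x. 0))"

definition ell2_restrict :: "'a set \<Rightarrow> 'a vec_op \<Rightarrow> 'a vec_op" where
  "ell2_restrict A T = (\<lambda>f. if f \<in> ell2 A then T f else (\<lambda>x. 0))"

definition ell2_kernel :: "'a set \<Rightarrow> 'a vec_op \<Rightarrow> 'a vec set" where
  "ell2_kernel A T = {f \<in> ell2 A. T f = (\<lambda>x. 0)}"

text \<open>On basis vectors, left translation by \<open>h\<close> sends \<open>\<delta>\<^sub>x\<close> to \<open>\<delta>\<^bsub>hx\<^esub>\<close> and right translation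
  sends \<open>\<delta>\<^sub>x\<close> to \<open>\<delta>\<^bsub>xh\<^esub>\<close>.\<close>

definition left_trans :: "('a, 'b) monoid_scheme \<Rightarrow> 'a \<Rightarrow> 'a vec_op" where
  "left_trans H h f = (\<lambda>x. if x \<in> carrier H then f (inv\<^bsub>H\<^esub> h \<otimes>\<^bsub>H\<^esub> x) else 0)"

definition right_trans :: "('a, 'b) monoid_scheme \<Rightarrow> 'a \<Rightarrow> 'a vec_op" where
  "right_trans H h f = (\<lambda>x. if x \<in> carrier H then f (x \<otimes>\<^bsub>H\<^esub> inv\<^bsub>H\<^esub> h) else 0)"

text \<open>The group von Neumann algebra of \<open>H\<close>, acting on \<open>\<ell>\<^sup>2H\<close> from the left.\<close>

definition group_vN :: "('a, 'b) monoid_scheme \<Rightarrow> 'a vec_op ring" where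
  "group_vN H =
     \<lparr>carrier = {T. ell2_bounded_op (carrier H) T \<and>
                    (\<forall>h\<in>carrier H. \<forall>f\<in>ell2 (carrier H).
                       T (right_trans H h f) = right_trans H h (T f))},
      monoid.mult = (\<lambda>S T. S \<circ> T),
      monoid.one = ell2_restrict (carrier H) (\<lambda>f. f),
      ring.zero = (\<lambda>f x. 0),
      ring.add = (\<lambda>S T f x. S f x + T f x)\<rparr>"

definition vN_trace :: "('a, 'b) monoid_scheme \<Rightarrow> 'a vec_op \<Rightarrow> complex" where
  "vN_trace H T = ell2_inner (carrier H) (T (ell2_delta \<one>\<^bsub>H\<^esub>)) (ell2_delta \<one>\<^bsub>H\<^esub>)"

text \<open>Orthogonal projection onto \<open>V\<close>, meaningful for closed subspaces \<open>V\<close> of \<open>\<ell>\<^sup>2A\<close>.\<close>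

definition ell2_proj :: "'a set \<Rightarrow> 'a vec set \<Rightarrow> 'a vec_op" where
  "ell2_proj A V = ell2_restrict A
     (\<lambda>f. THE g. g \<in> V \<and> (\<forall>v\<in>V. ell2_inner A (\<lambda>x. f x - g x) v = 0))"

text \<open>Von Neumann dimension of a closed \<open>H\<close>-invariant subspace \<open>V\<close> of \<open>\<ell>\<^sup>2H\<close>.\<close>

definition vN_dim :: "('a, 'b) monoid_scheme \<Rightarrow> 'a vec set \<Rightarrow> real" where
  "vN_dim H V = Re (vN_trace H (ell2_proj (carrier H) V))"

text \<open>
  The embedding of \<open>\<N>K\<close> into \<open>\<N>G\<close> for a subgroup \<open>K\<close>: split \<open>\<ell>\<^sup>2G\<close> as the sum of the
  subspaces \<open>\<ell>\<^sup>2(Kg)\<close>, identify each with \<open>\<ell>\<^sup>2K\<close> by right translation by \<open>g\<close>, and let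
  \<open>T\<close> act on every summand. The value at \<open>g\<close> is read off at the point \<open>\<one>\<close> of \<open>K\<close>.
\<close>

definition vN_induce :: "('a, 'b) monoid_scheme \<Rightarrow> 'a set \<Rightarrow> 'a vec_op \<Rightarrow> 'a vec_op" where
  "vN_induce G K T = ell2_restrict (carrier G)
     (\<lambda>f g. if g \<in> carrier G
            then T (\<lambda>k. if k \<in> K then f (k \<otimes>\<^bsub>G\<^esub> g) else 0) \<one>\<^bsub>G\<^esub> else 0)"

text \<open>
  For normal \<open>K\<close>, the conjugate \<open>g T g\<inverse>\<close> is formed in \<open>\<N>G\<close>, where \<open>g\<close> is left translation
  by \<open>g\<close>; the result is again in the image of \<open>\<N>K\<close>, and the corresponding element of \<open>\<N>K\<close> is
  recovered by restriction to \<open>\<ell>\<^sup>2K\<close>.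
\<close>

definition vN_conj :: "('a, 'b) monoid_scheme \<Rightarrow> 'a set \<Rightarrow> 'a \<Rightarrow> 'a vec_op \<Rightarrow> 'a vec_op" where
  "vN_conj G K g T =
     ell2_restrict K (left_trans G g \<circ> vN_induce G K T \<circ> left_trans G (inv\<^bsub>G\<^esub> g))"

text \<open>
  Twisted Laurent polynomials \<open>\<Sum>i. t\<^sup>i p\<^sub>i\<close> over \<open>R\<close>, given by their coefficient families
  \<open>p\<close>, where \<open>\<alpha> j a\<close> plays the role of \<open>t\<^sup>j a t\<^bsup>-j\<^esup>\<close>. The product comes from
  \<open>t\<^sup>i a t\<^sup>j b = t\<^bsup>i+j\<^esup> (t\<^bsup>-j\<^esup> a t\<^sup>j) b\<close>, here with \<open>j = n - i\<close>.
\<close>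

definition twisted_laurent ::
    "('r, 'm) ring_scheme \<Rightarrow> (int \<Rightarrow> 'r \<Rightarrow> 'r) \<Rightarrow> (int \<Rightarrow> 'r) ring" where
  "twisted_laurent R \<alpha> =
     \<lparr>carrier = {p. (\<forall>i. p i \<in> carrier R) \<and> finite {i. p i \<noteq> \<zero>\<^bsub>R\<^esub>}},
      monoid.mult = (\<lambda>p q n. \<Oplus>\<^bsub>R\<^esub>i\<in>{i. p i \<noteq> \<zero>\<^bsub>R\<^esub>}. \<alpha> (- (n - i)) (p i) \<otimes>\<^bsub>R\<^esub> q (n - i)),
      monoid.one = (\<lambda>i. if i = 0 then \<one>\<^bsub>R\<^esub> else \<zero>\<^bsub>R\<^esub>),
      ring.zero = (\<lambda>i. \<zero>\<^bsub>R\<^esub>),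
      ring.add = (\<lambda>p q i. p i \<oplus>\<^bsub>R\<^esub> q i)\<rparr>"

definition laurent_init :: "('r, 'm) ring_scheme \<Rightarrow> (int \<Rightarrow> 'r) \<Rightarrow> (int \<Rightarrow> 'r)" where
  "laurent_init R p =
     (if p = (\<lambda>i. \<zero>\<^bsub>R\<^esub>) then (\<lambda>i. \<zero>\<^bsub>R\<^esub>)
      else (\<lambda>i. if i = Min {j. p j \<noteq> \<zero>\<^bsub>R\<^esub>} then p i else \<zero>\<^bsub>R\<^esub>))"

text \<open>Pure part of a monomial \<open>m = t\<^sup>k a\<close>, i.e. its only non-zero coefficient \<open>a\<close> (or \<open>0\<close>).\<close>

definition pure_part :: "('r, 'm) ring_scheme \<Rightarrow> (int \<Rightarrow> 'r) \<Rightarrow> 'r" where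
  "pure_part R m =
     (if m = (\<lambda>i. \<zero>\<^bsub>R\<^esub>) then \<zero>\<^bsub>R\<^esub> else m (THE k. m k \<noteq> \<zero>\<^bsub>R\<^esub>))"

abbreviation kernel_group :: "('a, 'b) monoid_scheme \<Rightarrow> ('a \<Rightarrow> int) \<Rightarrow> ('a, 'b) monoid_scheme" where
  "kernel_group G \<phi> \<equiv> G\<lparr>carrier := kernel G integer_group \<phi>\<rparr>"

definition vN_laurent ::
    "('a, 'b) monoid_scheme \<Rightarrow> ('a \<Rightarrow> int) \<Rightarrow> 'a \<Rightarrow> (int \<Rightarrow> 'a vec_op) ring" where
  "vN_laurent G \<phi> t =
     twisted_laurent (group_vN (kernel_group G \<phi>))
       (\<lambda>j. vN_conj G (kernel G integer_group \<phi>) (t [^]\<^bsub>G\<^esub> j))"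

definition vN_nullity ::
    "('a, 'b) monoid_scheme \<Rightarrow> ('a \<Rightarrow> int) \<Rightarrow> (int \<Rightarrow> 'a vec_op) \<Rightarrow> real" where
  "vN_nullity G \<phi> x =
     (let K = kernel_group G \<phi>; R = group_vN K
      in vN_dim K (ell2_kernel (carrier K) (pure_part R (laurent_init R x))))"

end

theory Submission
  imports Defs
begin

text \<open>
  Let \<open>d\<close> bound the distance between the lowest and the highest exponent in \<open>q\<close> and in \<open>q'\<close>.
  Shift exponents so that both initial terms sit in degree \<open>0\<close>. For polynomials \<open>r, r'\<close> with
  coefficients in degrees \<open>0..n\<close>, the equation \<open>q r = q' r'\<close> is a system of \<open>n + d + 1\<close> linear
  equations in \<open>2 (n + 1)\<close> unknowns over \<open>\<N>K\<close>. Solved in \<open>\<ell>\<^sup>2K\<close> instead of \<open>\<N>K\<close>, it has a closed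
  invariant space \<open>W\<^sub>0\<close> of solutions of von Neumann dimension at least \<open>n + 1 - d\<close>. Filter it by the
  spaces \<open>W\<^sub>i\<close> of solutions that live in degrees \<open>i..n\<close>. Since \<open>W\<^bsub>n+1\<^esub> = 0\<close>, some layer
  \<open>W\<^sub>i / W\<^bsub>i+1\<^esub>\<close> has dimension at least \<open>1 - d / (n + 1)\<close>. A layer embeds into the pairs of
  leading coefficients \<open>(r\<^sub>i, r'\<^sub>i)\<close>, and those with \<open>r\<^sub>i = 0\<close> satisfy \<open>q'\<^sub>0 r'\<^sub>i = 0\<close>, so the
  leading coefficients \<open>r\<^sub>i\<close> that occur fill a subspace of dimension at least
  \<open>1 - d / (n + 1) - null q'\<close>.

  The orthogonal projection \<open>P\<close> onto \<open>W\<^sub>i\<close> is a matrix over \<open>\<N>K\<close>, and its columns are honest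
  solutions with coefficients in \<open>\<N>K\<close>. The column that belongs to the unknown \<open>r\<^sub>i\<close> has the
  compression of \<open>P\<close> to that coordinate as its leading coefficient. A vector is killed by this
  compression only if it is orthogonal to all leading coefficients occurring in \<open>W\<^sub>i\<close>, so its
  kernel has dimension at most \<open>null q' + d / (n + 1)\<close>. This gives \<open>r\<close>. Comparing coefficients in
  degree \<open>i\<close> gives \<open>q\<^sub>0 r\<^sub>i = q'\<^sub>0 r'\<^sub>i\<close> up to conjugation, and
  \<open>ker r'\<^sub>i \<subseteq> ker (q\<^sub>0 r\<^sub>i)\<close> gives the bound for \<open>r'\<close>.

  All dimension counts rest on one inequality, \<open>vdim_le_kernel_plus_range\<close>: if \<open>A\<close> maps \<open>V\<close> into
  \<open>U\<close>, then \<open>dim V \<le> dim (V \<inter> ker A) + dim U\<close>. It follows from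
  \<open>dim (ker T) = dim (ker T\<^sup>*)\<close> for square matrices \<open>T\<close>. For \<open>\<parallel>T\<parallel> \<le> 1\<close> the projection onto \<open>ker T\<close> is
  the strong limit of \<open>(1 - T\<^sup>* T)\<^sup>n\<close> along even \<open>n\<close>, and the trace property gives
  \<open>tr (1 - T\<^sup>* T)\<^sup>n = tr (1 - T T\<^sup>*)\<^sup>n\<close>. This construction yields the projections onto kernels at the
  same time, and they inherit equivariance from \<open>T\<close>.

  The Hilbert space arguments are carried out over the reals with inner product \<open>Re \<langle>f, g\<rangle>\<close>.
  Complex linearity is then one more symmetry with which operators have to commute.
\<close>

section \<open>Adjoints and orthogonal projections in real Hilbert spaces\<close>

text \<open>
  The representing vector minimises \<open>\<parallel>x\<parallel>\<^sup>2 - 2 L x\<close>. By the parallelogram law a minimising sequence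
  is Cauchy, so completeness supplies a minimiser, and stationarity there is the claim.
\<close>

lemma riesz_representation:
  fixes L :: "'h::{real_inner,complete_space} \<Rightarrow> real"
  assumes "bounded_linear L"
  shows "\<exists>z. \<forall>x. L x = inner z x"
proof -
  interpret bounded_linear L by fact
  obtain C where C: "\<And>x. \<bar>L x\<bar> \<le> C * norm x" and "C > 0"
    using pos_bounded by (auto simp: mult.commute)
  define g where "g x = (norm x)\<^sup>2 - 2 * L x" for x
  define m where "m = Inf (range g)"
  have low: "- (C\<^sup>2) \<le> g x" for x
  proof -
    have "L x \<le> C * norm x" using C[of x] by linarith
    moreover have "0 \<le> (norm x - C)\<^sup>2" by simp
    ultimately show ?thesis unfolding g_def power2_diff by (simp add: algebra_simps)
  qed
  have bdd: "bdd_below (range g)" using low by (auto intro!: bdd_belowI)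
  have m_le: "m \<le> g x" for x unfolding m_def using bdd by (auto intro: cInf_lower)
  have par: "(norm (x - y))\<^sup>2 = 2 * g x + 2 * g y - 4 * g ((1/2) *\<^sub>R (x + y))" for x y
    unfolding g_def scaleR add power2_norm_eq_inner
    by (simp add: inner_simps inner_commute field_simps)
  have "\<exists>x. g x < m + 1 / real (Suc n)" for n
    using cInf_lessD[of "range g" "m + 1 / real (Suc n)"] unfolding m_def by auto
  then obtain u where u: "\<And>n. g (u n) < m + 1 / real (Suc n)" by metis
  have "Cauchy u"
  proof (rule metric_CauchyI)
    fix e :: real assume "e > 0"
    then obtain N where N: "1 / real (Suc N) < e\<^sup>2 / 4"
      using nat_approx_posE[of "e\<^sup>2 / 4"] by auto
    have *: "1 / real (Suc n) < e\<^sup>2 / 4" if "n \<ge> N" for n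
      using N that by (smt (verit) frac_le of_nat_0_less_iff of_nat_mono Suc_le_mono zero_less_Suc)
    have "dist (u a) (u b) < e" if "a \<ge> N" "b \<ge> N" for a b
    proof -
      have "(norm (u a - u b))\<^sup>2 < e\<^sup>2"
        using par[of "u a" "u b"] u[of a] u[of b] *[OF that(1)] *[OF that(2)]
          m_le[of "(1/2) *\<^sub>R (u a + u b)"] by linarith
      then show ?thesis using \<open>e > 0\<close> by (simp add: dist_norm power2_less_imp_less)
    qed
    then show "\<exists>M. \<forall>a\<ge>M. \<forall>b\<ge>M. dist (u a) (u b) < e" by blast
  qed
  then obtain z where z: "u \<longlonglongrightarrow> z" using Cauchy_convergent convergent_def by blast
  have "(\<lambda>n. g (u n)) \<longlonglongrightarrow> g z"
    unfolding g_def by (intro tendsto_intros tendsto z)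
  moreover have "(\<lambda>n. m + 1 / real (Suc n)) \<longlonglongrightarrow> m + 0"
    by (intro tendsto_intros LIMSEQ_Suc[OF lim_1_over_n])
  ultimately have "g z \<le> m"
    using u by (intro LIMSEQ_le) (auto intro!: exI[of _ 0] less_imp_le)
  then have min: "g z \<le> g x" for x using m_le[of x] by linarith
  have "L x = inner z x" for x
  proof (cases "x = 0")
    case True then show ?thesis by (simp add: zero)
  next
    case False
    define b where "b = inner z x - L x"
    \<comment> \<open>The minimiser of \<open>g\<close> on the line through \<open>z\<close> in direction \<open>x\<close>.\<close>
    define s where "s = - b / (norm x)\<^sup>2"
    have "g (z + s *\<^sub>R x) = g z + s\<^sup>2 * (norm x)\<^sup>2 + 2 * s * b"
      unfolding g_def add scaleR b_def power2_norm_eq_inner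
      by (simp add: inner_simps inner_commute algebra_simps power2_eq_square)
    moreover have "s\<^sup>2 * (norm x)\<^sup>2 + 2 * s * b = - (b\<^sup>2 / (norm x)\<^sup>2)"
      unfolding s_def using False by (simp add: field_simps power2_eq_square)
    ultimately have "b\<^sup>2 / (norm x)\<^sup>2 \<le> 0" using min[of "z + s *\<^sub>R x"] by linarith
    then have "b = 0" using False by (simp add: divide_le_0_iff)
    then show ?thesis by (simp add: b_def)
  qed
  then show ?thesis by blast
qed

lemma inner_adjoint:
  fixes T :: "'h::{real_inner,complete_space} \<Rightarrow> 'k::real_inner"
  assumes "bounded_linear T"
  shows "inner (T x) y = inner x (adjoint T y)"
proof -
  have "\<exists>z. \<forall>x. inner (T x) y = inner z x" for y
    by (rule riesz_representation)
      (intro bounded_linear_compose[OF bounded_linear_inner_left assms])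
  then obtain S where "\<And>y x. inner (T x) y = inner (S y) x" by metis
  then have "\<exists>S. \<forall>x y. inner (T x) y = inner x (S y)"
    by (auto simp: inner_commute intro!: exI[of _ S])
  from someI_ex[OF this] show ?thesis unfolding adjoint_def by blast
qed

lemma eq_if_inner_eq: "(\<And>z. inner x z = inner y z) \<Longrightarrow> x = (y::'h::real_inner)"
  by (metis inner_diff_left inner_eq_zero_iff right_minus_eq)

lemma norm_adjoint_le:
  fixes T :: "'h::{real_inner,complete_space} \<Rightarrow> 'k::real_inner"
  assumes T: "bounded_linear T" and C: "\<And>x. norm (T x) \<le> C * norm x" and "C \<ge> 0"
  shows "norm (adjoint T y) \<le> C * norm y"
proof -
  have "(norm (adjoint T y))\<^sup>2 = inner (T (adjoint T y)) y"
    by (simp add: power2_norm_eq_inner inner_adjoint[OF T])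
  also have "\<dots> \<le> norm (T (adjoint T y)) * norm y" by (rule norm_cauchy_schwarz)
  also have "\<dots> \<le> C * norm (adjoint T y) * norm y" by (intro mult_right_mono C) simp
  finally have "norm (adjoint T y) * norm (adjoint T y) \<le> norm (adjoint T y) * (C * norm y)"
    by (simp add: power2_eq_square mult_ac)
  then show ?thesis
    using \<open>C \<ge> 0\<close> by (cases "adjoint T y = 0") (auto simp: mult_le_cancel_left)
qed

lemma bounded_linear_adjoint:
  fixes T :: "'h::{real_inner,complete_space} \<Rightarrow> 'k::real_inner"
  assumes T: "bounded_linear T"
  shows "bounded_linear (adjoint T)"
proof -
  note adj = inner_adjoint[OF T, symmetric]
  obtain C where C: "\<And>x. norm (T x) \<le> C * norm x" and "C > 0"
    using bounded_linear.pos_bounded[OF T] by (auto simp: mult.commute)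
  show ?thesis
  proof (rule bounded_linear_intro)
    show "adjoint T (x + y) = adjoint T x + adjoint T y" for x y
      by (rule eq_if_inner_eq) (simp add: inner_commute[of _ "_::'h"] inner_add_right adj)
    show "adjoint T (r *\<^sub>R x) = r *\<^sub>R adjoint T x" for r x
      by (rule eq_if_inner_eq) (simp add: inner_commute[of _ "_::'h"] adj)
    show "norm (adjoint T x) \<le> norm x * C" for x
      using norm_adjoint_le[OF T C] \<open>C > 0\<close> by (simp add: mult.commute)
  qed
qed

lemma adjoint_adjoint_bounded:
  fixes T :: "'h::{real_inner,complete_space} \<Rightarrow> 'k::{real_inner,complete_space}"
  assumes "bounded_linear T"
  shows "adjoint (adjoint T) = T"
  by (rule adjoint_unique) (metis inner_adjoint[OF assms] inner_commute)

definition is_proj :: "('h::real_inner \<Rightarrow> 'h) \<Rightarrow> 'h set \<Rightarrow> bool" where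
  "is_proj P V \<longleftrightarrow> (\<forall>x. P x \<in> V \<and> (\<forall>v\<in>V. inner (x - P x) v = 0))"

lemma is_projD:
  assumes "is_proj P V"
  shows "P x \<in> V" and "v \<in> V \<Longrightarrow> inner (P x) v = inner x v"
proof -
  show "P x \<in> V" using assms unfolding is_proj_def by blast
  show "inner (P x) v = inner x v" if "v \<in> V"
  proof -
    have "inner (x - P x) v = 0" using assms that unfolding is_proj_def by blast
    then show ?thesis by (simp only: inner_diff_left right_minus_eq)
  qed
qed

lemma is_proj_apply_mem:
  assumes "is_proj P V" "subspace V" "v \<in> V"
  shows "P v = v"
proof -
  have "P v - v \<in> V"
    by (rule subspace_diff[OF assms(2) is_projD(1)[OF assms(1)] assms(3)])
  then have "inner (P v - v) (P v - v) = 0"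
    using is_projD(2)[OF assms(1), of "P v - v" v] by (simp add: inner_diff_left)
  then show ?thesis by simp
qed

lemma is_proj_unique:
  assumes "is_proj P V" "is_proj P' V" "subspace V"
  shows "P = P'"
proof
  fix x
  have "P x - P' x \<in> V"
    by (rule subspace_diff[OF assms(3) is_projD(1)[OF assms(1)] is_projD(1)[OF assms(2)]])
  then have "inner (P x - P' x) (P x - P' x) = 0"
    using is_projD(2)[OF assms(1), of "P x - P' x" x] is_projD(2)[OF assms(2), of "P x - P' x" x]
    by (simp add: inner_diff_left)
  then show "P x = P' x" by simp
qed

lemma is_proj_inner:
  assumes "is_proj P V"
  shows "inner (P x) (P y) = inner x (P y)"
  by (rule is_projD(2)[OF assms is_projD(1)[OF assms]])

lemma is_proj_inner_self:
  assumes "is_proj P V"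
  shows "inner (P x) x = (norm (P x))\<^sup>2"
  unfolding power2_norm_eq_inner is_proj_inner[OF assms, of x x] by (rule inner_commute)

lemma is_proj_selfadjoint:
  assumes "is_proj P V"
  shows "inner (P x) y = inner x (P y)"
proof -
  have "inner (P x) y = inner (P y) (P x)"
    unfolding is_proj_inner[OF assms, of y x] by (rule inner_commute)
  also have "\<dots> = inner (P x) (P y)" by (rule inner_commute)
  also have "\<dots> = inner x (P y)" by (rule is_proj_inner[OF assms])
  finally show ?thesis .
qed

lemma is_proj_mono:
  assumes P: "is_proj P V" and Q: "is_proj Q W" and "V \<subseteq> W"
  shows "inner (P x) x \<le> inner (Q x) x"
proof -
  have "inner (P x) x = inner (P x) (Q x)"
  proof -
    have "P x \<in> W" using is_projD(1)[OF P, of x] \<open>V \<subseteq> W\<close> by blast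
    from is_projD(2)[OF Q this, of x] have "inner (P x) x = inner (Q x) (P x)"
      by (simp only: inner_commute[of x])
    then show ?thesis by (simp only: inner_commute[of "Q x"])
  qed
  also have "\<dots> \<le> norm (P x) * norm (Q x)" by (rule norm_cauchy_schwarz)
  finally have "norm (P x) * norm (P x) \<le> norm (P x) * norm (Q x)"
    by (simp add: is_proj_inner_self[OF P] power2_eq_square)
  then have "norm (P x) \<le> norm (Q x)"
    by (cases "norm (P x) = 0") (auto simp: mult_le_cancel_left)
  then show ?thesis unfolding is_proj_inner_self[OF P] is_proj_inner_self[OF Q]
    by (intro power_mono) auto
qed

text \<open>
  The numbers \<open>\<parallel>S\<^sup>n x\<parallel>\<^sup>2\<close> decrease, and the inner product of \<open>S\<^bsup>2n\<^esup> x\<close> and \<open>S\<^bsup>2k\<^esup> x\<close> is the one with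
  index \<open>n + k\<close>. Hence the even powers form a Cauchy sequence at every vector.
\<close>

lemma even_powers_converge_to_proj:
  fixes S :: "'h::{real_inner,complete_space} \<Rightarrow> 'h"
  assumes S: "bounded_linear S" and sa: "\<And>x y. inner (S x) y = inner x (S y)"
    and contr: "\<And>x. norm (S x) \<le> norm x"
  shows "\<exists>P. is_proj P {x. S (S x) = x} \<and> (\<forall>x. (\<lambda>n. (S ^^ (2 * n)) x) \<longlonglongrightarrow> P x)"
proof -
  have sak: "inner ((S ^^ k) x) y = inner x ((S ^^ k) y)" for k x y
  proof (induction k arbitrary: x y)
    case (Suc k)
    have "inner ((S ^^ Suc k) x) y = inner ((S ^^ k) x) (S y)" by (simp add: sa)
    also have "\<dots> = inner x ((S ^^ Suc k) y)" by (simp only: Suc funpow_Suc_right comp_apply)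
    finally show ?case .
  qed simp
  have "\<exists>l. (\<lambda>n. (S ^^ (2 * n)) x) \<longlonglongrightarrow> l" for x
  proof -
    define h where "h n = (norm ((S ^^ n) x))\<^sup>2" for n
    have "decseq h" unfolding h_def by (rule decseq_SucI) (auto intro!: power_mono contr)
    then have "convergent h"
      by (intro Bseq_monoseq_convergent decseq_imp_monoseq decseq_bounded[where B = 0])
         (auto simp: h_def)
    then have hC: "Cauchy h" by (rule convergent_Cauchy)
    have key: "(norm ((S ^^ (2*n)) x - (S ^^ (2*k)) x))\<^sup>2 = h (2*n) - 2 * h (n+k) + h (2*k)" for n k
    proof -
      have "inner ((S ^^ (2*n)) x) ((S ^^ (2*k)) x) = inner ((S ^^ (n+k)) x) ((S ^^ (n+k)) x)"
      proof -
        have "(S ^^ (2*n)) ((S ^^ (2*k)) x) = (S ^^ (2*n + 2*k)) x" by (simp add: funpow_add)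
        also have "2*n + 2*k = (n+k) + (n+k)" by simp
        also have "(S ^^ ((n+k) + (n+k))) x = (S ^^ (n+k)) ((S ^^ (n+k)) x)"
          by (simp only: funpow_add comp_apply)
        finally show ?thesis unfolding sak by simp
      qed
      then show ?thesis
        by (simp add: h_def power2_norm_eq_inner inner_diff_left inner_diff_right inner_commute)
    qed
    have "Cauchy (\<lambda>n. (S ^^ (2 * n)) x)"
    proof (rule metric_CauchyI)
      fix e :: real assume "e > 0"
      then have "e\<^sup>2 / 2 > 0" by simp
      from metric_CauchyD[OF hC this] obtain M where
        M: "\<And>a b. a \<ge> M \<Longrightarrow> b \<ge> M \<Longrightarrow> \<bar>h a - h b\<bar> < e\<^sup>2 / 2" by (auto simp: dist_real_def)
      have "dist ((S ^^ (2 * n)) x) ((S ^^ (2 * k)) x) < e" if "n \<ge> M" "k \<ge> M" for n k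
      proof -
        have "h (2*n) - h (n+k) < e\<^sup>2 / 2" "h (2*k) - h (n+k) < e\<^sup>2 / 2"
          by (rule order_le_less_trans[OF abs_ge_self M]; use that in simp)+
        then have "(norm ((S ^^ (2*n)) x - (S ^^ (2*k)) x))\<^sup>2 < e\<^sup>2"
          unfolding key by linarith
        then show ?thesis using \<open>e > 0\<close> by (simp add: dist_norm power2_less_imp_less)
      qed
      then show "\<exists>M. \<forall>n\<ge>M. \<forall>k\<ge>M. dist ((S ^^ (2 * n)) x) ((S ^^ (2 * k)) x) < e" by blast
    qed
    then show ?thesis using Cauchy_convergent convergent_def by blast
  qed
  then obtain P where P: "\<And>x. (\<lambda>n. (S ^^ (2 * n)) x) \<longlonglongrightarrow> P x" by metis
  have "S (S (P x)) = P x" for x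
  proof (rule LIMSEQ_unique)
    show "(\<lambda>n. S (S ((S ^^ (2 * n)) x))) \<longlonglongrightarrow> S (S (P x))"
      by (intro bounded_linear.tendsto[OF S] P)
    show "(\<lambda>n. S (S ((S ^^ (2 * n)) x))) \<longlonglongrightarrow> P x"
      using LIMSEQ_Suc[OF P[of x]] by simp
  qed
  moreover have "inner (x - P x) v = 0" if "S (S v) = v" for x v
  proof -
    have fixed: "(S ^^ (2 * n)) v = v" for n by (induction n) (auto simp: that)
    have "(\<lambda>n. inner ((S ^^ (2 * n)) x) v) \<longlonglongrightarrow> inner (P x) v"
      by (intro tendsto_intros P)
    moreover have "(\<lambda>n. inner ((S ^^ (2 * n)) x) v) \<longlonglongrightarrow> inner x v"
      by (simp add: sak fixed)
    ultimately show ?thesis using LIMSEQ_unique by (fastforce simp: inner_diff_left)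
  qed
  ultimately show ?thesis using P by (auto simp: is_proj_def intro!: exI[of _ P])
qed

text \<open>
  The projection onto the kernel is a pointwise limit of polynomials in \<open>T\<^sup>* T\<close>. This makes
  it equivariant whenever \<open>T\<close> is and makes its trace accessible.
\<close>

lemma proj_kernel_of_contraction:
  fixes T :: "'h::{real_inner,complete_space} \<Rightarrow> 'h"
  assumes T: "bounded_linear T" and contr: "\<And>x. norm (T x) \<le> norm x"
  shows "\<exists>P. is_proj P {x. T x = 0} \<and>
    (\<forall>x. (\<lambda>n. ((\<lambda>x. x - adjoint T (T x)) ^^ (2 * n)) x) \<longlonglongrightarrow> P x)"
proof -
  define S where "S x = x - adjoint T (T x)" for x
  note blT = bounded_linear_compose[OF bounded_linear_adjoint[OF T] T]
  have S: "bounded_linear S" unfolding S_def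
    by (intro bounded_linear_sub bounded_linear_ident blT)
  have sa: "inner (S x) y = inner x (S y)" for x y
    unfolding S_def inner_diff_left inner_diff_right inner_adjoint[OF T, symmetric]
    by (metis inner_adjoint[OF T] inner_commute)
  have S_le: "(norm (S x))\<^sup>2 \<le> (norm x)\<^sup>2 - (norm (T x))\<^sup>2" for x
  proof -
    have 1: "inner x (adjoint T (T x)) = (norm (T x))\<^sup>2"
      unfolding inner_adjoint[OF T, symmetric] power2_norm_eq_inner ..
    have "norm (adjoint T (T x)) \<le> 1 * norm (T x)"
      by (rule norm_adjoint_le[OF T]) (use contr in auto)
    then have "(norm (adjoint T (T x)))\<^sup>2 \<le> (norm (T x))\<^sup>2" by (intro power_mono) auto
    moreover have "(norm (S x))\<^sup>2 = (norm x)\<^sup>2 - 2 * inner x (adjoint T (T x)) + (norm (adjoint T (T x)))\<^sup>2"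
      unfolding S_def power2_norm_eq_inner
      by (simp add: inner_diff_left inner_diff_right inner_commute)
    ultimately show ?thesis using 1 by linarith
  qed
  have contrS: "norm (S x) \<le> norm x" for x
  proof (rule power2_le_imp_le)
    show "(norm (S x))\<^sup>2 \<le> (norm x)\<^sup>2"
      using S_le[of x] zero_le_power2[of "norm (T x)"] by linarith
  qed simp
  have "{x. S (S x) = x} = {x. T x = 0}"
  proof (intro Collect_cong iffI)
    fix x assume "S (S x) = x"
    then have "norm x \<le> norm (S x)" using contrS[of "S x"] by simp
    then have "(norm x)\<^sup>2 \<le> (norm (S x))\<^sup>2" by (intro power_mono) auto
    then have "(norm (T x))\<^sup>2 \<le> 0" using S_le[of x] by linarith
    then show "T x = 0" by simp
  next
    fix x assume "T x = 0"
    then have "S x = x" by (simp add: S_def linear_simps[OF bounded_linear_adjoint[OF T]])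
    then show "S (S x) = x" by simp
  qed
  then show ?thesis using even_powers_converge_to_proj[OF S sa contrS] unfolding S_def by simp
qed

section \<open>Dimension of invariant subspaces from a finite trace\<close>

definition commutant :: "('h::real_normed_vector \<Rightarrow> 'h) set \<Rightarrow> ('h \<Rightarrow> 'h) set" where
  "commutant Rs = {T. bounded_linear T \<and> (\<forall>R\<in>Rs. \<forall>x. T (R x) = R (T x))}"

lemma commutant_bounded_linear: "T \<in> commutant Rs \<Longrightarrow> bounded_linear T"
  by (simp add: commutant_def)

lemma commutant_comp: "S \<in> commutant Rs \<Longrightarrow> T \<in> commutant Rs \<Longrightarrow> (\<lambda>x. S (T x)) \<in> commutant Rs"
  by (simp add: commutant_def bounded_linear_compose)

lemma commutant_id: "(\<lambda>x. x) \<in> commutant Rs"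
  by (simp add: commutant_def bounded_linear_ident)

lemma commutant_funpow:
  assumes "T \<in> commutant Rs"
  shows "T ^^ k \<in> commutant Rs"
proof (induction k)
  case 0
  then show ?case using commutant_id by (simp add: id_def)
next
  case (Suc k)
  from commutant_comp[OF assms this] show ?case by (simp add: comp_def)
qed

lemma commutant_adjoint:
  fixes Rs :: "('h::{real_inner,complete_space} \<Rightarrow> 'h) set"
  assumes "T \<in> commutant Rs"
    and adj: "\<And>R. R \<in> Rs \<Longrightarrow> \<exists>S\<in>Rs. \<forall>x y. inner (R x) y = inner x (S y)"
  shows "adjoint T \<in> commutant Rs"
proof -
  note T = commutant_bounded_linear[OF assms(1)]
  have "adjoint T (R x) = R (adjoint T x)" if R: "R \<in> Rs" for R x
  proof (rule eq_if_inner_eq)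
    fix z
    from adj[OF R] obtain S where S: "S \<in> Rs" "\<And>x y. inner (R x) y = inner x (S y)"
      by blast
    have "inner (adjoint T (R x)) z = inner (T z) (R x)"
      unfolding inner_adjoint[OF T] by (rule inner_commute)
    also have "\<dots> = inner x (S (T z))" unfolding inner_commute[of "T z"] S(2) ..
    also have "S (T z) = T (S z)" using assms(1) S(1) by (simp add: commutant_def)
    also have "inner x (T (S z)) = inner (adjoint T x) (S z)"
      unfolding inner_commute[of x] inner_adjoint[OF T] by (rule inner_commute)
    also have "\<dots> = inner (R (adjoint T x)) z" by (rule S(2)[symmetric])
    finally show "inner (adjoint T (R x)) z = inner (R (adjoint T x)) z" .
  qed
  then show ?thesis by (simp add: commutant_def bounded_linear_adjoint[OF T])
qed

text \<open>
  The commutant of a self-adjoint family \<open>Rs\<close> plays the role of the matrices over a finite von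
  Neumann algebra, and \<open>T \<mapsto> \<Sum>i\<in>I. \<langle>T e\<^sub>i, e\<^sub>i\<rangle>\<close> that of the trace of a matrix. The trace
  property is only required as \<open>tr (T\<^sup>* T) = tr (T T\<^sup>*)\<close>.
\<close>

locale traced_commutant =
  fixes Rs :: "('h::{real_inner,complete_space} \<Rightarrow> 'h) set"
    and I :: "'i set" and e :: "'i \<Rightarrow> 'h"
  assumes finite_I: "finite I"
    and unit_e: "i \<in> I \<Longrightarrow> inner (e i) (e i) = 1"
    and Rs_bounded_linear: "R \<in> Rs \<Longrightarrow> bounded_linear R"
    and Rs_adjoint: "R \<in> Rs \<Longrightarrow> \<exists>S\<in>Rs. \<forall>x y. inner (R x) y = inner x (S y)"
    and norm_trace: "T \<in> commutant Rs \<Longrightarrow>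
      (\<Sum>i\<in>I. (norm (T (e i)))\<^sup>2) = (\<Sum>i\<in>I. (norm (adjoint T (e i)))\<^sup>2)"
begin

abbreviation M :: "('h \<Rightarrow> 'h) set" where "M \<equiv> commutant Rs"

lemma M_add: "S \<in> M \<Longrightarrow> T \<in> M \<Longrightarrow> (\<lambda>x. S x + T x) \<in> M"
  and M_diff: "S \<in> M \<Longrightarrow> T \<in> M \<Longrightarrow> (\<lambda>x. S x - T x) \<in> M"
  and M_scaleR: "T \<in> M \<Longrightarrow> (\<lambda>x. c *\<^sub>R T x) \<in> M"
  using Rs_bounded_linear
  by (auto simp: commutant_def bounded_linear_add bounded_linear_sub linear_simps
      intro: bounded_linear_compose[OF bounded_linear_scaleR_right])

lemma M_sum:
  assumes "finite A" "\<And>i. i \<in> A \<Longrightarrow> T i \<in> M"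
  shows "(\<lambda>x. \<Sum>i\<in>A. T i x) \<in> M"
  using assms
proof (induction A rule: finite_induct)
  case empty
  then show ?case using M_diff[OF commutant_id commutant_id] by simp
next
  case (insert i A)
  then show ?case using M_add[of "T i" "\<lambda>x. \<Sum>i\<in>A. T i x"] by simp
qed

lemma M_adjoint: "T \<in> M \<Longrightarrow> adjoint T \<in> M"
  by (rule commutant_adjoint[OF _ Rs_adjoint])

definition tr :: "('h \<Rightarrow> 'h) \<Rightarrow> real" where
  "tr T = (\<Sum>i\<in>I. inner (T (e i)) (e i))"

text \<open>
  Polarisation of \<open>tr (T\<^sup>* T) = tr (T T\<^sup>*)\<close>.
\<close>

lemma sum_inner_adjoint:
  assumes A: "A \<in> M" and B: "B \<in> M"
  shows "(\<Sum>i\<in>I. inner (A (e i)) (B (e i))) = (\<Sum>i\<in>I. inner (adjoint A (e i)) (adjoint B (e i)))"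
proof -
  note blA = commutant_bounded_linear[OF A] and blB = commutant_bounded_linear[OF B]
  have adj: "adjoint (\<lambda>x. A x + B x) = (\<lambda>x. adjoint A x + adjoint B x)"
    by (rule adjoint_unique)
      (simp add: inner_add_left inner_add_right inner_adjoint[OF blA] inner_adjoint[OF blB])
  have pol: "2 * inner x y = (norm (x + y))\<^sup>2 - (norm x)\<^sup>2 - (norm y)\<^sup>2" for x y :: 'h
    by (simp add: power2_norm_eq_inner inner_add_left inner_add_right inner_commute)
  have "2 * (\<Sum>i\<in>I. inner (A (e i)) (B (e i))) = (\<Sum>i\<in>I. (norm (A (e i) + B (e i)))\<^sup>2)
      - (\<Sum>i\<in>I. (norm (A (e i)))\<^sup>2) - (\<Sum>i\<in>I. (norm (B (e i)))\<^sup>2)"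
    unfolding sum_distrib_left pol by (simp add: sum_subtractf)
  also have "\<dots> = (\<Sum>i\<in>I. (norm (adjoint A (e i) + adjoint B (e i)))\<^sup>2)
      - (\<Sum>i\<in>I. (norm (adjoint A (e i)))\<^sup>2) - (\<Sum>i\<in>I. (norm (adjoint B (e i)))\<^sup>2)"
    using norm_trace[OF A] norm_trace[OF B] norm_trace[OF M_add[OF A B]] unfolding adj by simp
  also have "\<dots> = 2 * (\<Sum>i\<in>I. inner (adjoint A (e i)) (adjoint B (e i)))"
    unfolding sum_distrib_left pol by (simp add: sum_subtractf)
  finally show ?thesis by simp
qed

lemma tr_swap:
  assumes A: "A \<in> M" and B: "B \<in> M"
  shows "tr (\<lambda>x. adjoint A (B x)) = tr (\<lambda>x. B (adjoint A x))"
proof -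
  note blA = commutant_bounded_linear[OF A] and blB = commutant_bounded_linear[OF B]
  have "tr (\<lambda>x. adjoint A (B x)) = (\<Sum>i\<in>I. inner (A (e i)) (B (e i)))"
    unfolding tr_def inner_commute[of _ "e _"] inner_adjoint[OF blA, symmetric] ..
  also have "\<dots> = (\<Sum>i\<in>I. inner (adjoint A (e i)) (adjoint B (e i)))"
    by (rule sum_inner_adjoint[OF A B])
  also have "\<dots> = tr (\<lambda>x. B (adjoint A x))"
    unfolding tr_def inner_adjoint[OF blB] ..
  finally show ?thesis .
qed

definition vdim :: "'h set \<Rightarrow> real" where
  "vdim V = tr (SOME P. is_proj P V)"

lemma vdim_eq_tr:
  assumes "is_proj P V" "subspace V"
  shows "vdim V = tr P"
  unfolding vdim_def
  by (rule someI2[of _ P]) (use assms is_proj_unique in blast)+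

lemma subspace_kernel_M: "T \<in> M \<Longrightarrow> subspace {x. T x = 0}"
  by (rule linear_subspace_kernel[OF bounded_linear.linear[OF commutant_bounded_linear]])

text \<open>
  The trace is a finite sum of vector functionals, so it passes to the pointwise limit that
  defines the projection onto the kernel.
\<close>

lemma contraction_kernel:
  assumes T: "T \<in> M" and contr: "\<And>x. norm (T x) \<le> norm x"
  shows "\<exists>P\<in>M. is_proj P {x. T x = 0} \<and>
    (\<lambda>n. tr ((\<lambda>x. x - adjoint T (T x)) ^^ (2 * n))) \<longlonglongrightarrow> tr P"
proof -
  define S where "S x = x - adjoint T (T x)" for x
  have SM: "S \<in> M" unfolding S_def
    by (rule M_diff[OF commutant_id commutant_comp[OF M_adjoint[OF T] T]])
  note Sk = commutant_funpow[OF SM]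
  from proj_kernel_of_contraction[OF commutant_bounded_linear[OF T] contr] obtain P
    where P: "is_proj P {x. T x = 0}" and lim: "\<And>x. (\<lambda>n. (S ^^ (2 * n)) x) \<longlonglongrightarrow> P x"
    unfolding S_def[abs_def] by blast
  have lin: "linear P"
  proof (rule linearI)
    fix x y and r :: real
    have "(\<lambda>n. (S ^^ (2 * n)) (x + y)) \<longlonglongrightarrow> P x + P y"
      unfolding linear_simps(1)[OF commutant_bounded_linear[OF Sk]] by (intro tendsto_intros lim)
    then show "P (x + y) = P x + P y" using lim[of "x + y"] by (rule LIMSEQ_unique[rotated])
    have "(\<lambda>n. (S ^^ (2 * n)) (r *\<^sub>R x)) \<longlonglongrightarrow> r *\<^sub>R P x"
      unfolding linear_simps(5)[OF commutant_bounded_linear[OF Sk]] by (intro tendsto_intros lim)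
    then show "P (r *\<^sub>R x) = r *\<^sub>R P x" using lim[of "r *\<^sub>R x"] by (rule LIMSEQ_unique[rotated])
  qed
  have "norm (P x) \<le> norm x * 1" for x
  proof -
    have "norm (P x) * norm (P x) = inner (P x) x"
      unfolding is_proj_inner_self[OF P] by (simp add: power2_eq_square)
    also have "\<dots> \<le> norm (P x) * norm x" by (rule norm_cauchy_schwarz)
    finally show ?thesis by (cases "P x = 0") (auto simp: mult_le_cancel_left)
  qed
  then have "bounded_linear P"
    using lin by (intro bounded_linear_intro[where K = 1]) (auto simp: linear_add linear_scale)
  moreover have "P (R x) = R (P x)" if R: "R \<in> Rs" for R x
  proof (rule LIMSEQ_unique[OF lim])
    have "(S ^^ (2 * n)) (R x) = R ((S ^^ (2 * n)) x)" for n
      using Sk[of "2 * n"] R unfolding commutant_def by blast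
    then show "(\<lambda>n. (S ^^ (2 * n)) (R x)) \<longlonglongrightarrow> R (P x)"
      using bounded_linear.tendsto[OF Rs_bounded_linear[OF R] lim] by simp
  qed
  ultimately have PM: "P \<in> M" by (simp add: commutant_def)
  have "(\<lambda>n. tr (S ^^ (2 * n))) \<longlonglongrightarrow> tr P"
    unfolding tr_def by (intro tendsto_intros lim)
  then show ?thesis using P PM unfolding S_def[abs_def] by blast
qed

text \<open>
  With \<open>S = 1 - T\<^sup>* T\<close> and \<open>S' = 1 - T T\<^sup>*\<close> one has \<open>T S\<^sup>k = S'\<^sup>k T\<close>. So the trace property turns
  \<open>tr (T\<^sup>* T S\<^sup>k)\<close> into \<open>tr (S'\<^sup>k T T\<^sup>*)\<close>, which is the induction step.
\<close>

lemma tr_defect_powers: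
  assumes T: "T \<in> M"
  shows "tr ((\<lambda>x. x - adjoint T (T x)) ^^ k) = tr ((\<lambda>x. x - T (adjoint T x)) ^^ k)"
proof (induction k)
  case (Suc k)
  define S where "S x = x - adjoint T (T x)" for x
  define S' where "S' x = x - T (adjoint T x)" for x
  note blT = commutant_bounded_linear[OF T]
  have SM: "S \<in> M" unfolding S_def
    by (rule M_diff[OF commutant_id commutant_comp[OF M_adjoint[OF T] T]])
  note Sk = commutant_funpow[OF SM]
  have twine: "T ((S ^^ k) x) = (S' ^^ k) (T x)" for k x
    by (induction k arbitrary: x) (auto simp: S_def S'_def linear_simps[OF blT])
  have "S' ((S' ^^ k) x) = (S' ^^ k) (S' x)" for x by (rule funpow_swap1)
  have lin': "(S' ^^ k) (x - y) = (S' ^^ k) x - (S' ^^ k) y" for k x y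
    by (induction k arbitrary: x y)
      (auto simp: S'_def linear_simps[OF blT] linear_simps[OF bounded_linear_adjoint[OF blT]])
  have "tr (S ^^ Suc k) = tr (S ^^ k) - tr (\<lambda>x. adjoint T (T ((S ^^ k) x)))"
    by (simp add: tr_def S_def inner_diff_left sum_subtractf)
  also have "tr (\<lambda>x. adjoint T (T ((S ^^ k) x))) = tr (\<lambda>x. T ((S ^^ k) (adjoint T x)))"
    by (rule tr_swap[OF T commutant_comp[OF T Sk]])
  also have "\<dots> = tr (\<lambda>x. (S' ^^ k) (T (adjoint T x)))" by (simp only: twine)
  also have "tr (S ^^ k) - \<dots> = tr (S' ^^ k) - \<dots>" using Suc unfolding S_def S'_def by simp
  also have "\<dots> = tr (\<lambda>x. (S' ^^ k) (S' x))"
    unfolding tr_def by (simp add: S'_def[of "e _"] lin' inner_diff_left sum_subtractf)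
  also have "\<dots> = tr (S' ^^ Suc k)" by (simp only: funpow_Suc_right comp_def)
  finally show ?case unfolding S_def S'_def .
qed simp

text \<open>
  Scaling makes \<open>T\<close> a contraction without changing any kernel. The traces of the two projections
  are then limits of the same sequence.
\<close>

lemma kernel_and_adjoint_kernel:
  assumes T: "T \<in> M"
  shows "(\<exists>P\<in>M. is_proj P {x. T x = 0}) \<and> vdim {x. T x = 0} = vdim {x. adjoint T x = 0}"
proof -
  note blT = commutant_bounded_linear[OF T]
  obtain C where C: "\<And>x. norm (T x) \<le> C * norm x" and "C > 0"
    using bounded_linear.pos_bounded[OF blT] by (auto simp: mult.commute)
  define A where "A x = (1 / C) *\<^sub>R T x" for x
  have adjA: "adjoint A = (\<lambda>x. (1 / C) *\<^sub>R adjoint T x)"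
    by (rule adjoint_unique) (simp add: A_def inner_adjoint[OF blT])
  have AM: "A \<in> M" unfolding A_def by (rule M_scaleR[OF T])
  note blA = commutant_bounded_linear[OF AM]
  have contr: "norm (A x) \<le> norm x" for x
    using C[of x] \<open>C > 0\<close> by (simp add: A_def field_simps)
  have contr': "norm (adjoint A x) \<le> norm x" for x
    using norm_adjoint_le[OF blA, of 1 x] contr by simp
  have ker: "{x. A x = 0} = {x. T x = 0}" "{x. adjoint A x = 0} = {x. adjoint T x = 0}"
    using \<open>C > 0\<close> by (auto simp: A_def adjA)
  from contraction_kernel[OF AM contr] obtain P where P: "P \<in> M" "is_proj P {x. T x = 0}"
    "(\<lambda>n. tr ((\<lambda>x. x - adjoint A (A x)) ^^ (2 * n))) \<longlonglongrightarrow> tr P" unfolding ker by blast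
  from contraction_kernel[OF M_adjoint[OF AM] contr'] obtain Q
    where Q: "Q \<in> M" "is_proj Q {x. adjoint T x = 0}"
    "(\<lambda>n. tr ((\<lambda>x. x - A (adjoint A x)) ^^ (2 * n))) \<longlonglongrightarrow> tr Q"
    unfolding ker adjoint_adjoint_bounded[OF blA] by blast
  have "tr P = tr Q" using LIMSEQ_unique[OF P(3)] Q(3) unfolding tr_defect_powers[OF AM] by blast
  then have "vdim {x. T x = 0} = vdim {x. adjoint T x = 0}"
    using vdim_eq_tr[OF P(2) subspace_kernel_M[OF T]]
      vdim_eq_tr[OF Q(2) subspace_kernel_M[OF M_adjoint[OF T]]] by simp
  then show ?thesis using P(1,2) by blast
qed

text \<open>
  The subspaces that have a dimension here. Stating membership by a kernel rather than by
  closedness and invariance gives the projection at once.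
\<close>

definition kernels :: "'h set set" where
  "kernels = {V. \<exists>T\<in>M. V = {x. T x = 0}}"

lemma kernelsI: "T \<in> M \<Longrightarrow> V = {x. T x = 0} \<Longrightarrow> V \<in> kernels"
  by (auto simp: kernels_def)

lemma kernels_subspace: "V \<in> kernels \<Longrightarrow> subspace V"
  by (auto simp: kernels_def subspace_kernel_M)

lemma kernels_proj: "V \<in> kernels \<Longrightarrow> \<exists>P\<in>M. is_proj P V"
  by (auto simp: kernels_def kernel_and_adjoint_kernel)

text \<open>
  A sum \<open>S\<^sup>* S + T\<^sup>* T\<close> kills exactly the vectors killed by both \<open>S\<close> and \<open>T\<close>.
\<close>

lemma kernels_Int:
  assumes "V \<in> kernels" "W \<in> kernels"
  shows "V \<inter> W \<in> kernels"
proof -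
  obtain S T where S: "S \<in> M" "V = {x. S x = 0}" and T: "T \<in> M" "W = {x. T x = 0}"
    using assms by (auto simp: kernels_def)
  note blS = commutant_bounded_linear[OF S(1)] and blT = commutant_bounded_linear[OF T(1)]
  define A where "A x = adjoint S (S x) + adjoint T (T x)" for x
  have "A \<in> M" unfolding A_def 
    by (rule M_add[OF commutant_comp[OF M_adjoint[OF S(1)] S(1)]
          commutant_comp[OF M_adjoint[OF T(1)] T(1)]])
  moreover have "A x = 0 \<longleftrightarrow> S x = 0 \<and> T x = 0" for x
  proof
    assume "A x = 0"
    then have "inner x (A x) = 0" by simp
    then have "(norm (S x))\<^sup>2 + (norm (T x))\<^sup>2 = 0"
      by (simp add: A_def inner_add_right inner_adjoint[OF blS, symmetric]
          inner_adjoint[OF blT, symmetric] power2_norm_eq_inner)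
    then show "S x = 0 \<and> T x = 0" by (simp add: add_nonneg_eq_0_iff)
  qed (simp add: A_def linear_simps[OF bounded_linear_adjoint[OF blS]]
      linear_simps[OF bounded_linear_adjoint[OF blT]])
  ultimately show ?thesis unfolding S(2) T(2) by (intro kernelsI) auto
qed

lemma vdim_mono:
  assumes "V \<in> kernels" "W \<in> kernels" "V \<subseteq> W"
  shows "vdim V \<le> vdim W"
proof -
  obtain P Q where "is_proj P V" "is_proj Q W" using assms kernels_proj by blast
  then show ?thesis using assms(3)
    by (simp add: vdim_eq_tr kernels_subspace assms(1,2) tr_def is_proj_mono sum_mono)
qed

lemma tr_id_diff: "tr (\<lambda>x. x - P x) = real (card I) - tr P"
  by (simp add: tr_def inner_diff_left sum_subtractf unit_e)

lemma vdim_orthogonal: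
  assumes "P \<in> M" "is_proj P V" "subspace V"
  shows "{x. P x = 0} \<in> kernels" and "vdim {x. P x = 0} = real (card I) - vdim V"
proof -
  show 1: "{x. P x = 0} \<in> kernels" by (intro kernelsI[OF assms(1)]) auto
  note bl = commutant_bounded_linear[OF assms(1)]
  have "is_proj (\<lambda>x. x - P x) {x. P x = 0}"
    unfolding is_proj_def
    using is_proj_apply_mem[OF assms(2,3)] is_projD(1)[OF assms(2)] is_proj_selfadjoint[OF assms(2)]
    by (simp add: linear_simps[OF bl])
  then show "vdim {x. P x = 0} = real (card I) - vdim V"
    using 1 assms by (simp add: vdim_eq_tr kernels_subspace tr_id_diff)
qed

text \<open>
  Let \<open>P\<close> and \<open>Q\<close> be the projections onto \<open>V\<close> and \<open>U\<close>, and \<open>T = A P\<close>. The kernel of \<open>T\<close> is the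
  orthogonal sum of \<open>ker P\<close> and \<open>V \<inter> ker A\<close>, while \<open>T\<^sup>* = P A\<^sup>*\<close> kills the orthogonal complement
  \<open>ker Q\<close> of \<open>U\<close>. Now compare the dimensions of \<open>ker T\<close> and \<open>ker T\<^sup>*\<close>.
\<close>

theorem vdim_le_kernel_plus_range:
  assumes V: "V \<in> kernels" and U: "U \<in> kernels" and A: "A \<in> M"
    and AV: "\<And>v. v \<in> V \<Longrightarrow> A v \<in> U"
  shows "vdim V \<le> vdim {v \<in> V. A v = 0} + vdim U"
proof -
  define V0 where "V0 = {v \<in> V. A v = 0}"
  have V0: "V0 \<in> kernels"
    using kernels_Int[OF V kernelsI[OF A refl]] by (simp add: V0_def Int_def)
  obtain P where P: "P \<in> M" "is_proj P V" using kernels_proj[OF V] by blast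
  obtain P0 where P0: "P0 \<in> M" "is_proj P0 V0" using kernels_proj[OF V0] by blast
  obtain Q where Q: "Q \<in> M" "is_proj Q U" using kernels_proj[OF U] by blast
  note bl = commutant_bounded_linear[OF A] commutant_bounded_linear[OF P(1)]
  note sub = kernels_subspace[OF V] kernels_subspace[OF V0] kernels_subspace[OF U]
  define T where "T x = A (P x)" for x
  have T: "T \<in> M" unfolding T_def by (rule commutant_comp[OF A P(1)])
  have PP0: "P (P0 x) = P0 x" and AP0: "A (P0 x) = 0" for x
    using is_projD(1)[OF P0(2), of x] is_proj_apply_mem[OF P(2) sub(1)] by (auto simp: V0_def)
  have PP: "P (P x) = P x" for x
    by (rule is_proj_apply_mem[OF P(2) sub(1) is_projD(1)[OF P(2)]])
  have "is_proj (\<lambda>x. (x - P x) + P0 x) {x. T x = 0}"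
    unfolding is_proj_def
  proof (intro allI conjI ballI)
    fix x
    show "x - P x + P0 x \<in> {x. T x = 0}"
      by (simp add: T_def linear_simps[OF bl(2)] PP0 PP AP0)
    fix y assume "y \<in> {x. T x = 0}"
    then have "P y \<in> V0" using is_projD(1)[OF P(2)] by (simp add: T_def V0_def)
    have "inner (x - (x - P x + P0 x)) y = inner (P x) y - inner (P (P0 x)) y"
      by (simp add: inner_diff_left PP0)
    also have "\<dots> = inner x (P y) - inner (P0 x) (P y)"
      by (simp only: is_proj_selfadjoint[OF P(2)])
    also have "\<dots> = 0" using is_projD(2)[OF P0(2) \<open>P y \<in> V0\<close>, of x] by linarith
    finally show "inner (x - (x - P x + P0 x)) y = 0" .
  qed
  then have "vdim {x. T x = 0} = tr (\<lambda>x. (x - P x) + P0 x)"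
    by (rule vdim_eq_tr[OF _ subspace_kernel_M[OF T]])
  also have "\<dots> = real (card I) - vdim V + vdim V0"
    using tr_id_diff[of P] vdim_eq_tr[OF P(2) sub(1)] vdim_eq_tr[OF P0(2) sub(2)]
    by (simp add: tr_def inner_add_left sum.distrib)
  finally have 1: "vdim {x. T x = 0} = real (card I) - vdim V + vdim V0" .
  have "{x. Q x = 0} \<subseteq> {x. adjoint T x = 0}"
  proof
    fix x assume x: "x \<in> {x. Q x = 0}"
    have "inner (adjoint T x) z = 0" for z
    proof -
      have "T z \<in> U" unfolding T_def by (rule AV[OF is_projD(1)[OF P(2)]])
      then have "Q (T z) = T z" by (rule is_proj_apply_mem[OF Q(2) sub(3)])
      then have "inner (T z) x = inner (T z) (Q x)"
        using is_proj_selfadjoint[OF Q(2), of "T z" x] by simp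
      then have "inner (T z) x = 0" using x by simp
      then show ?thesis
        unfolding inner_adjoint[OF commutant_bounded_linear[OF T]] by (simp only: inner_commute)
    qed
    then show "x \<in> {x. adjoint T x = 0}" using inner_eq_zero_iff by blast
  qed
  then have "vdim {x. Q x = 0} \<le> vdim {x. adjoint T x = 0}"
    by (intro vdim_mono vdim_orthogonal(1)[OF Q sub(3)] kernelsI[OF M_adjoint[OF T]]) auto
  then have "real (card I) - vdim U \<le> vdim {x. T x = 0}"
    using kernel_and_adjoint_kernel[OF T] vdim_orthogonal(2)[OF Q sub(3)] by simp
  then show ?thesis using 1 unfolding V0_def by linarith
qed

end

section \<open>The Hilbert space of square-summable functions\<close>

typedef 'x l2 = "{f :: 'x \<Rightarrow> complex. (\<lambda>x. (cmod (f x))\<^sup>2) summable_on UNIV}"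
  morphisms coord Abs_l2
  by (rule exI[of _ "\<lambda>_. 0"]) auto

setup_lifting type_definition_l2

lemma l2_eqI: "(\<And>x. coord f x = coord g x) \<Longrightarrow> f = g"
  by (auto simp: coord_inject[symmetric])

lemma coord_summable: "(\<lambda>x. (cmod (coord f x))\<^sup>2) summable_on UNIV"
  using coord[of f] by simp

lemma square_summable_add:
  fixes f g :: "'x \<Rightarrow> complex"
  assumes "(\<lambda>x. (cmod (f x))\<^sup>2) summable_on A" "(\<lambda>x. (cmod (g x))\<^sup>2) summable_on A"
  shows "(\<lambda>x. (cmod (f x + g x))\<^sup>2) summable_on A"
proof (rule summable_on_comparison_test)
  show "(\<lambda>x. 2 * (cmod (f x))\<^sup>2 + 2 * (cmod (g x))\<^sup>2) summable_on A"
    by (intro summable_on_add summable_on_cmult_right assms)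
  fix x
  have "(cmod (f x + g x))\<^sup>2 \<le> (cmod (f x) + cmod (g x))\<^sup>2"
    by (intro power_mono norm_triangle_ineq) auto
  also have "\<dots> \<le> 2 * (cmod (f x))\<^sup>2 + 2 * (cmod (g x))\<^sup>2"
    using zero_le_power2[of "cmod (f x) - cmod (g x)"] by (simp add: power2_eq_square algebra_simps)
  finally show "(cmod (f x + g x))\<^sup>2 \<le> 2 * (cmod (f x))\<^sup>2 + 2 * (cmod (g x))\<^sup>2" .
qed simp

lemma square_summable_mult:
  fixes f :: "'x \<Rightarrow> complex"
  assumes "(\<lambda>x. (cmod (f x))\<^sup>2) summable_on A"
  shows "(\<lambda>x. (cmod (c * f x))\<^sup>2) summable_on A"
  using summable_on_cmult_right[OF assms, of "(cmod c)\<^sup>2"] by (simp add: norm_mult power_mult_distrib)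

instantiation l2 :: (type) real_vector
begin

lift_definition zero_l2 :: "'a l2" is "\<lambda>_. 0" by simp
lift_definition plus_l2 :: "'a l2 \<Rightarrow> 'a l2 \<Rightarrow> 'a l2" is "\<lambda>f g x. f x + g x"
  by (rule square_summable_add)
lift_definition minus_l2 :: "'a l2 \<Rightarrow> 'a l2 \<Rightarrow> 'a l2" is "\<lambda>f g x. f x - g x"
  using square_summable_add square_summable_mult[of _ _ "- 1"] by fastforce
lift_definition uminus_l2 :: "'a l2 \<Rightarrow> 'a l2" is "\<lambda>f x. - f x" by simp
lift_definition scaleR_l2 :: "real \<Rightarrow> 'a l2 \<Rightarrow> 'a l2" is "\<lambda>r f x. complex_of_real r * f x"
  by (rule square_summable_mult)

instance
  by standard (transfer, simp add: algebra_simps fun_eq_iff)+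

end

lemmas coord_simps [simp] = zero_l2.rep_eq plus_l2.rep_eq minus_l2.rep_eq uminus_l2.rep_eq
  scaleR_l2.rep_eq

lemma coord_sum: "coord (sum f A) x = (\<Sum>i\<in>A. coord (f i) x)"
  by (induction A rule: infinite_finite_induct) auto

lemma coord_inner_summable: "(\<lambda>x. inner (coord f x) (coord g x)) summable_on A"
proof (rule summable_on_subset_banach)
  have "(\<lambda>x. (cmod (coord f x))\<^sup>2 + (cmod (coord g x))\<^sup>2) summable_on UNIV"
    by (intro summable_on_add coord_summable)
  then have "(\<lambda>x. norm (inner (coord f x) (coord g x))) summable_on UNIV"
  proof (rule summable_on_comparison_test)
    fix x
    have "norm (inner (coord f x) (coord g x)) \<le> cmod (coord f x) * cmod (coord g x)"
      by (simp add: Cauchy_Schwarz_ineq2)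
    also have "\<dots> \<le> (cmod (coord f x))\<^sup>2 + (cmod (coord g x))\<^sup>2"
      using zero_le_power2[of "cmod (coord f x) - cmod (coord g x)"]
        zero_le_power2[of "cmod (coord f x)"] zero_le_power2[of "cmod (coord g x)"]
      unfolding power2_diff by linarith
    finally show "norm (inner (coord f x) (coord g x)) \<le>
      (cmod (coord f x))\<^sup>2 + (cmod (coord g x))\<^sup>2" .
  qed auto
  then show "(\<lambda>x. inner (coord f x) (coord g x)) summable_on UNIV"
    by (rule abs_summable_summable)
qed simp

text \<open>
  The inner product of two complex numbers as plane vectors is \<open>Re (z * cnj w)\<close>, so this is the
  real part of the complex inner product.
\<close>

instantiation l2 :: (type) real_inner
begin

definition inner_l2 :: "'a l2 \<Rightarrow> 'a l2 \<Rightarrow> real" where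
  "inner_l2 f g = (\<Sum>\<^sub>\<infinity>x. inner (coord f x) (coord g x))"
definition norm_l2 :: "'a l2 \<Rightarrow> real" where
  "norm_l2 f = sqrt (inner f f)"
definition sgn_l2 :: "'a l2 \<Rightarrow> 'a l2" where
  "sgn_l2 f = f /\<^sub>R norm f"
definition dist_l2 :: "'a l2 \<Rightarrow> 'a l2 \<Rightarrow> real" where
  "dist_l2 f g = norm (f - g)"
definition uniformity_l2 :: "('a l2 \<times> 'a l2) filter" where
  "uniformity_l2 = (INF e\<in>{0<..}. principal {(x, y). dist x y < e})"
definition open_l2 :: "'a l2 set \<Rightarrow> bool" where
  "open_l2 U = (\<forall>x\<in>U. \<forall>\<^sub>F (x', y) in uniformity. x' = x \<longrightarrow> y \<in> U)"

instance
proof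
  fix f g h :: "'a l2" and r :: real and U :: "'a l2 set"
  show "dist f g = norm (f - g)" by (simp add: dist_l2_def)
  show "sgn f = f /\<^sub>R norm f" by (simp add: sgn_l2_def)
  show "uniformity = (INF e\<in>{0<..}. principal {(x, y::'a l2). dist x y < e})"
    by (simp add: uniformity_l2_def)
  show "open U = (\<forall>x\<in>U. \<forall>\<^sub>F (x', y) in uniformity. x' = x \<longrightarrow> y \<in> U)"
    by (simp add: open_l2_def)
  show "inner f g = inner g f" by (simp add: inner_l2_def inner_commute)
  show "inner (f + g) h = inner f h + inner g h"
    by (simp add: inner_l2_def inner_add_left infsum_add coord_inner_summable)
  show "inner (r *\<^sub>R f) g = r * inner f g"
  proof -
    have "inner (coord (r *\<^sub>R f) x) (coord g x) = r * inner (coord f x) (coord g x)" for x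
      by (simp add: inner_complex_def algebra_simps)
    then show ?thesis by (simp only: inner_l2_def infsum_cmult_right[OF coord_inner_summable])
  qed
  show "0 \<le> inner f f" by (simp add: inner_l2_def infsum_nonneg)
  show "inner f f = 0 \<longleftrightarrow> f = 0"
  proof
    assume "inner f f = 0"
    then have "inner (coord f x) (coord f x) = 0" for x
      using nonneg_infsum_le_0D[OF _ coord_inner_summable[of f f UNIV], of x]
      by (simp add: inner_l2_def)
    then show "f = 0" by (intro l2_eqI) simp
  qed (simp add: inner_l2_def)
  show "norm f = sqrt (inner f f)" by (simp add: norm_l2_def)
qed

end

lemma norm_l2_square: "(norm f)\<^sup>2 = (\<Sum>\<^sub>\<infinity>x. (cmod (coord f x))\<^sup>2)"
  unfolding power2_norm_eq_inner inner_l2_def ..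

lemma sum_coord_le: "finite F \<Longrightarrow> (\<Sum>x\<in>F. (cmod (coord f x))\<^sup>2) \<le> (norm f)\<^sup>2"
  unfolding norm_l2_square by (rule finite_sum_le_infsum[OF coord_summable]) auto

lemma cmod_coord_le: "cmod (coord f x) \<le> norm f"
  by (rule power2_le_imp_le) (use sum_coord_le[of "{x}" f] in simp_all)

text \<open>
  A Cauchy sequence converges in every coordinate. The Cauchy bound carries over to the limit on
  finite sets of coordinates, uniformly in the set, hence on the whole index set.
\<close>

instance l2 :: (type) complete_space
proof
  fix f :: "nat \<Rightarrow> 'a l2" assume C: "Cauchy f"
  have "Cauchy (\<lambda>n. coord (f n) x)" for x
  proof (rule metric_CauchyI)
    fix e :: real assume "e > 0"
    from metric_CauchyD[OF C this] obtain N where "\<And>m n. m \<ge> N \<Longrightarrow> n \<ge> N \<Longrightarrow> dist (f m) (f n) < e"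
      by blast
    moreover have "dist (coord (f m) x) (coord (f n) x) \<le> dist (f m) (f n)" for m n
      using cmod_coord_le[of "f m - f n" x] by (simp add: dist_norm)
    ultimately show "\<exists>N. \<forall>m\<ge>N. \<forall>n\<ge>N. dist (coord (f m) x) (coord (f n) x) < e"
      using order_le_less_trans by blast
  qed
  then have "\<exists>l. (\<lambda>n. coord (f n) x) \<longlonglongrightarrow> l" for x
    using Cauchy_convergent convergent_def by blast
  then obtain g where g: "\<And>x. (\<lambda>n. coord (f n) x) \<longlonglongrightarrow> g x" by metis
  have tail: "\<exists>N. \<forall>n\<ge>N. \<forall>F. finite F \<longrightarrow> (\<Sum>x\<in>F. (cmod (coord (f n) x - g x))\<^sup>2) \<le> e\<^sup>2"
    if "e > 0" for e :: real
  proof -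
    from metric_CauchyD[OF C that] obtain N
      where N: "\<And>m n. m \<ge> N \<Longrightarrow> n \<ge> N \<Longrightarrow> dist (f m) (f n) < e" by blast
    have "(\<Sum>x\<in>F. (cmod (coord (f n) x - g x))\<^sup>2) \<le> e\<^sup>2" if "n \<ge> N" "finite F" for n F
    proof (rule LIMSEQ_le_const2)
      show "(\<lambda>m. \<Sum>x\<in>F. (cmod (coord (f n) x - coord (f m) x))\<^sup>2)
          \<longlonglongrightarrow> (\<Sum>x\<in>F. (cmod (coord (f n) x - g x))\<^sup>2)"
        by (intro tendsto_intros g)
      have "(\<Sum>x\<in>F. (cmod (coord (f n) x - coord (f m) x))\<^sup>2) \<le> e\<^sup>2" if "m \<ge> N" for m
      proof -
        have "(\<Sum>x\<in>F. (cmod (coord (f n) x - coord (f m) x))\<^sup>2) \<le> (norm (f n - f m))\<^sup>2"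
          using sum_coord_le[OF \<open>finite F\<close>, of "f n - f m"] by simp
        also have "\<dots> \<le> e\<^sup>2"
          using N[OF \<open>n \<ge> N\<close> \<open>m \<ge> N\<close>] by (intro power_mono) (auto simp: dist_norm)
        finally show ?thesis .
      qed
      then show "\<exists>M. \<forall>m\<ge>M. (\<Sum>x\<in>F. (cmod (coord (f n) x - coord (f m) x))\<^sup>2) \<le> e\<^sup>2" by blast
    qed
    then show ?thesis by blast
  qed
  have diff: "(\<lambda>x. (cmod (coord (f n) x - g x))\<^sup>2) summable_on UNIV"
    if "\<And>F. finite F \<Longrightarrow> (\<Sum>x\<in>F. (cmod (coord (f n) x - g x))\<^sup>2) \<le> e\<^sup>2" for n and e :: real
    by (rule nonneg_bdd_above_summable_on) (use that in \<open>auto intro!: bdd_aboveI[of _ "e\<^sup>2"]\<close>)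
  obtain N where "\<And>F. finite F \<Longrightarrow> (\<Sum>x\<in>F. (cmod (coord (f N) x - g x))\<^sup>2) \<le> 1\<^sup>2"
    using tail[of 1] by auto
  from square_summable_add[OF square_summable_mult[OF diff[OF this], of "- 1"] coord_summable[of "f N"]]
  have "(\<lambda>x. (cmod (g x))\<^sup>2) summable_on UNIV" by simp
  then have "coord (Abs_l2 g) = g" by (intro Abs_l2_inverse) simp
  then obtain l where l: "\<And>x. coord l x = g x" by metis
  have "f \<longlonglongrightarrow> l"
  proof (rule metric_LIMSEQ_I)
    fix e :: real assume "e > 0"
    then obtain N where N: "\<And>n F. n \<ge> N \<Longrightarrow> finite F \<Longrightarrow>
        (\<Sum>x\<in>F. (cmod (coord (f n) x - g x))\<^sup>2) \<le> (e / 2)\<^sup>2"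
      using tail[of "e / 2"] by auto
    have "dist (f n) l < e" if "n \<ge> N" for n
    proof -
      have "(norm (f n - l))\<^sup>2 \<le> (e / 2)\<^sup>2"
        unfolding norm_l2_square
        by (rule infsum_le_finite_sums[OF coord_summable]) (simp add: l N[OF that])
      then have "norm (f n - l) \<le> e / 2" by (rule power2_le_imp_le) (use \<open>e > 0\<close> in simp)
      then show ?thesis using \<open>e > 0\<close> by (simp add: dist_norm)
    qed
    then show "\<exists>N. \<forall>n\<ge>N. dist (f n) l < e" by blast
  qed
  then show "convergent f" by (auto simp: convergent_def)
qed

lift_definition cscale :: "complex \<Rightarrow> 'x l2 \<Rightarrow> 'x l2" is "\<lambda>c f x. c * f x"
  by (rule square_summable_mult)

lemmas coord_cscale [simp] = cscale.rep_eq

lemma inner_cscale: "inner (cscale c f) g = inner f (cscale (cnj c) g)"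
  unfolding inner_l2_def by (simp add: inner_complex_def algebra_simps)

lemma norm_cscale: "norm (cscale c f) = cmod c * norm f"
proof -
  have "(norm (cscale c f))\<^sup>2 = (cmod c * norm f)\<^sup>2"
    unfolding norm_l2_square power_mult_distrib
    by (simp add: norm_mult power_mult_distrib infsum_cmult_right coord_summable)
  then show ?thesis by (simp add: power2_eq_iff_nonneg)
qed

lemma bounded_linear_cscale: "bounded_linear (cscale c)"
  by (rule bounded_linear_intro[where K = "cmod c"])
    (auto intro: l2_eqI simp: algebra_simps norm_cscale)

lift_definition delta :: "'x \<Rightarrow> 'x l2" is ell2_delta
proof -
  fix x :: 'x
  have "(\<lambda>y. (cmod (ell2_delta x y))\<^sup>2) summable_on {x}" by simp
  then show "(\<lambda>y. (cmod (ell2_delta x y))\<^sup>2) summable_on UNIV"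
    by (rule summable_on_cong_neutral[THEN iffD1, rotated -1]) (auto simp: ell2_delta_def)
qed

lemma coord_delta: "coord (delta x) y = (if y = x then 1 else 0)"
  by (simp add: delta.rep_eq ell2_delta_def)

lemma inner_delta: "inner f (delta x) = Re (coord f x)"
proof -
  have "inner f (delta x) = (\<Sum>\<^sub>\<infinity>y\<in>{x}. inner (coord f y) (coord (delta x) y))"
    unfolding inner_l2_def by (rule infsum_cong_neutral) (auto simp: coord_delta)
  then show ?thesis by (simp add: coord_delta inner_complex_def)
qed

text \<open>
  The vector is read along \<open>s\<close> on \<open>A\<close> and set to zero elsewhere. For injective \<open>s\<close> this is a
  partial isometry. Coordinate projections and inclusions, translations and conjugations are all
  of this form, which provides their boundedness and their adjoints uniformly.
\<close>

definition pull :: "'y set \<Rightarrow> ('y \<Rightarrow> 'x) \<Rightarrow> 'x l2 \<Rightarrow> 'y l2" where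
  "pull A s f = Abs_l2 (\<lambda>y. if y \<in> A then coord f (s y) else 0)"

lemma pull_summable:
  assumes "inj_on s A"
  shows "(\<lambda>y. (cmod (if y \<in> A then coord f (s y) else 0))\<^sup>2) summable_on UNIV"
proof -
  have "(\<lambda>x. (cmod (coord f x))\<^sup>2) summable_on s ` A"
    by (rule summable_on_subset_banach[OF coord_summable]) simp
  then have "(\<lambda>y. (cmod (coord f (s y)))\<^sup>2) summable_on A"
    by (simp add: summable_on_reindex[OF assms] comp_def)
  then show ?thesis
    by (rule summable_on_cong_neutral[THEN iffD1, rotated -1]) auto
qed

lemma coord_pull:
  assumes "inj_on s A"
  shows "coord (pull A s f) y = (if y \<in> A then coord f (s y) else 0)"
  unfolding pull_def by (subst Abs_l2_inverse) (use pull_summable[OF assms] in auto)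

lemma inner_pull:
  assumes s: "inj_on s A" and B: "\<And>y. y \<in> A \<Longrightarrow> s y \<in> B \<and> u (s y) = y"
    and A: "\<And>x. x \<in> B \<Longrightarrow> u x \<in> A \<and> s (u x) = x"
  shows "inner (pull A s f) g = inner f (pull B u g)"
proof -
  have u: "inj_on u B" using A by (metis inj_onI)
  have bij: "bij_betw s A B" by (rule bij_betw_byWitness[where f' = u]) (use A B in auto)
  have "inner (pull A s f) g = (\<Sum>\<^sub>\<infinity>y\<in>A. inner (coord f (s y)) (coord g (u (s y))))"
    unfolding inner_l2_def by (rule infsum_cong_neutral) (auto simp: coord_pull[OF s] B)
  also have "\<dots> = (\<Sum>\<^sub>\<infinity>x\<in>B. inner (coord f x) (coord g (u x)))"
    by (rule infsum_reindex_bij_betw[OF bij])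
  also have "\<dots> = inner f (pull B u g)"
    unfolding inner_l2_def by (rule infsum_cong_neutral) (auto simp: coord_pull[OF u])
  finally show ?thesis .
qed

lemma norm_pull_le:
  assumes "inj_on s A"
  shows "norm (pull A s f) \<le> norm f"
proof -
  have "(norm (pull A s f))\<^sup>2 \<le> (norm f)\<^sup>2"
    unfolding norm_l2_square[of "pull A s f"]
  proof (rule infsum_le_finite_sums[OF coord_summable])
    fix F :: "'a set" assume F: "finite F"
    have "(\<Sum>y\<in>F. (cmod (coord (pull A s f) y))\<^sup>2) = (\<Sum>y\<in>F \<inter> A. (cmod (coord f (s y)))\<^sup>2)"
      using F by (simp add: coord_pull[OF assms] sum.inter_restrict if_distrib[of cmod]
          if_distrib[of "\<lambda>x. x\<^sup>2"] cong: if_cong)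
    also have "\<dots> = (\<Sum>x\<in>s ` (F \<inter> A). (cmod (coord f x))\<^sup>2)"
      by (rule sum.reindex_cong[of s, symmetric]) (use assms in \<open>auto intro: inj_on_subset\<close>)
    also have "\<dots> \<le> (norm f)\<^sup>2" using F by (intro sum_coord_le) auto
    finally show "(\<Sum>y\<in>F. (cmod (coord (pull A s f) y))\<^sup>2) \<le> (norm f)\<^sup>2" .
  qed
  then show ?thesis by (rule power2_le_imp_le) simp
qed

lemma bounded_linear_pull:
  assumes "inj_on s A"
  shows "bounded_linear (pull A s)"
  by (rule bounded_linear_intro[where K = 1])
    (auto intro!: l2_eqI simp: coord_pull[OF assms] norm_pull_le[OF assms])

section \<open>The trace on finitely many copies of a group\<close>

text \<open>
  The space \<open>\<ell>\<^sup>2(H \<times> I)\<close> of vectors indexed by \<open>I\<close> with entries in \<open>\<ell>\<^sup>2H\<close>, realised inside the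
  functions on a whole product type.
\<close>

locale l2_copies = group H for H :: "('a, 'b) monoid_scheme" (structure) +
  fixes I :: "'i set"
  assumes finite_index: "finite I"
begin

text \<open>
  Right translation on every copy. It also cuts off to \<open>carrier H \<times> I\<close>, so translation by the
  unit is the projection onto \<open>\<ell>\<^sup>2(H \<times> I)\<close>. Operators that commute with all of these therefore
  preserve that subspace.
\<close>

definition rshift :: "'a \<Rightarrow> ('a \<times> 'i) l2 \<Rightarrow> ('a \<times> 'i) l2" where
  "rshift h = pull (carrier H \<times> I) (\<lambda>(x, i). (x \<otimes> inv h, i))"

definition symmetries :: "(('a \<times> 'i) l2 \<Rightarrow> ('a \<times> 'i) l2) set" where
  "symmetries = rshift ` carrier H \<union> range cscale"

abbreviation basis :: "'i \<Rightarrow> ('a \<times> 'i) l2" where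
  "basis i \<equiv> delta (\<one>, i)"

lemma inj_rshift: "h \<in> carrier H \<Longrightarrow> inj_on (\<lambda>(x, i). (x \<otimes> inv h, i)) (carrier H \<times> I)"
  by (auto simp: inj_on_def)

lemma coord_rshift:
  "h \<in> carrier H \<Longrightarrow> coord (rshift h F) (x, i) =
    (if x \<in> carrier H \<and> i \<in> I then coord F (x \<otimes> inv h, i) else 0)"
  by (simp add: rshift_def coord_pull[OF inj_rshift])

lemma inner_rshift: "h \<in> carrier H \<Longrightarrow> inner (rshift h F) F' = inner F (rshift (inv h) F')"
  unfolding rshift_def by (rule inner_pull[OF inj_rshift]) (auto simp: m_assoc)

lemma rshift_basis: "h \<in> carrier H \<Longrightarrow> i \<in> I \<Longrightarrow> rshift h (basis i) = delta (h, i)"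
  by (auto intro!: l2_eqI simp: coord_rshift coord_delta inv_solve_right')

lemma rshift_cscale: "h \<in> carrier H \<Longrightarrow> rshift h (cscale c F) = cscale c (rshift h F)"
  by (auto intro!: l2_eqI simp: coord_rshift)

lemma symmetries_bounded_linear: "R \<in> symmetries \<Longrightarrow> bounded_linear R"
  by (auto simp: symmetries_def rshift_def bounded_linear_cscale bounded_linear_pull[OF inj_rshift])

lemma symmetries_adjoint:
  assumes "R \<in> symmetries"
  shows "\<exists>S\<in>symmetries. \<forall>x y. inner (R x) y = inner x (S y)"
  using assms unfolding symmetries_def
proof
  assume "R \<in> rshift ` carrier H"
  then obtain h where h: "h \<in> carrier H" "R = rshift h" by blast
  then show "\<exists>S\<in>rshift ` carrier H \<union> range cscale. \<forall>x y. inner (R x) y = inner x (S y)"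
    by (intro bexI[of _ "rshift (inv h)"]) (auto simp: inner_rshift)
next
  assume "R \<in> range cscale"
  then obtain c where "R = cscale c" by blast
  then show "\<exists>S\<in>rshift ` carrier H \<union> range cscale. \<forall>x y. inner (R x) y = inner x (S y)"
    by (intro bexI[of _ "cscale (cnj c)"]) (auto simp: inner_cscale)
qed

lemma commutant_rshift:
  "T \<in> commutant symmetries \<Longrightarrow> h \<in> carrier H \<Longrightarrow> T (rshift h F) = rshift h (T F)"
  by (simp add: commutant_def symmetries_def)

lemma commutant_cscale: "T \<in> commutant symmetries \<Longrightarrow> T (cscale c F) = cscale c (T F)"
  by (simp add: commutant_def symmetries_def)

text \<open>
  An equivariant operator acts by convolution, and passing to the adjoint replaces the convolution
  kernel \<open>f\<close> by \<open>k \<mapsto> cnj (f (inv k))\<close>.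
\<close>

lemma coord_adjoint_basis:
  assumes T: "T \<in> commutant symmetries" and k: "k \<in> carrier H" and ij: "i \<in> I" "j \<in> I"
  shows "coord (adjoint T (basis j)) (inv k, i) = cnj (coord (T (basis i)) (k, j))"
proof -
  note bl = commutant_bounded_linear[OF T]
  have 1: "inner (T F) (delta (k, j)) = inner (rshift (inv k) F) (adjoint T (basis j))" for F
  proof -
    have "inner (T F) (delta (k, j)) = inner (T F) (rshift k (basis j))"
      using k ij by (simp add: rshift_basis)
    also have "\<dots> = inner (rshift (inv k) (T F)) (basis j)"
      using inner_rshift[of "inv k" "T F" "basis j"] k by simp
    also have "\<dots> = inner (rshift (inv k) F) (adjoint T (basis j))"
      using k by (simp add: commutant_rshift[OF T, symmetric] inner_adjoint[OF bl])
    finally show ?thesis .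
  qed
  have re: "Re (coord (T (basis i)) (k, j)) = Re (coord (adjoint T (basis j)) (inv k, i))"
    using 1[of "basis i"] k ij by (simp add: rshift_basis inner_delta inner_commute[of "delta _"])
  \<comment> \<open>The real inner product with a basis vector sees only real parts; multiplying by \<open>- \<i>\<close>
    exposes the imaginary part.\<close>
  have "inner (T (cscale (- \<i>) (basis i))) (delta (k, j)) =
      inner (cscale (- \<i>) (rshift (inv k) (basis i))) (adjoint T (basis j))"
    unfolding 1 using k by (simp add: rshift_cscale)
  then have "Im (coord (T (basis i)) (k, j)) = - Im (coord (adjoint T (basis j)) (inv k, i))"
    unfolding commutant_cscale[OF T] inner_cscale[of _ "rshift _ _"]
    using k ij by (simp add: rshift_basis inner_delta inner_commute[of "delta _"])
  then show ?thesis using re by (simp add: complex_eq_iff)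
qed

lemma norm_square_supported:
  assumes "\<And>x i. x \<notin> carrier H \<or> i \<notin> I \<Longrightarrow> coord F (x, i) = 0"
  shows "(norm F)\<^sup>2 = (\<Sum>i\<in>I. \<Sum>\<^sub>\<infinity>k\<in>carrier H. (cmod (coord F (k, i)))\<^sup>2)"
proof -
  let ?f = "\<lambda>y. (cmod (coord F y))\<^sup>2"
  have sm: "?f summable_on A" for A by (rule summable_on_subset_banach[OF coord_summable]) simp
  have "(norm F)\<^sup>2 = infsum ?f (\<Union>i\<in>I. carrier H \<times> {i})"
    unfolding norm_l2_square by (rule infsum_cong_neutral) (use assms in auto)
  also have "\<dots> = (\<Sum>i\<in>I. infsum ?f (carrier H \<times> {i}))"
    by (rule sum_infsum[symmetric]) (auto simp: finite_index sm)
  also have "\<dots> = (\<Sum>i\<in>I. \<Sum>\<^sub>\<infinity>k\<in>carrier H. ?f (k, i))"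
    by (intro sum.cong refl infsum_reindex_bij_betw[symmetric]) (auto simp: bij_betw_def inj_on_def)
  finally show ?thesis .
qed

lemma commutant_basis_supported:
  assumes T: "T \<in> commutant symmetries" and "j \<in> I" and "x \<notin> carrier H \<or> i \<notin> I"
  shows "coord (T (basis j)) (x, i) = 0"
proof -
  have "T (basis j) = rshift \<one> (T (basis j))"
    using commutant_rshift[OF T one_closed, of "basis j"] \<open>j \<in> I\<close> by (simp add: rshift_basis)
  then have "coord (T (basis j)) (x, i) = coord (rshift \<one> (T (basis j))) (x, i)" by simp
  also have "\<dots> = 0" using assms(3) by (auto simp: coord_rshift)
  finally show ?thesis .
qed

text \<open>
  Both sides are the sum of the squared moduli of all convolution coefficients, on the right
  with \<open>i\<close>, \<open>j\<close> exchanged and \<open>k\<close> inverted.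
\<close>

lemma norm_trace_basis:
  assumes T: "T \<in> commutant symmetries"
  shows "(\<Sum>i\<in>I. (norm (T (basis i)))\<^sup>2) = (\<Sum>i\<in>I. (norm (adjoint T (basis i)))\<^sup>2)"
proof -
  note sup = commutant_basis_supported[OF T] commutant_basis_supported[OF commutant_adjoint[OF T symmetries_adjoint]]
  have "(\<Sum>i\<in>I. (norm (T (basis i)))\<^sup>2) =
      (\<Sum>i\<in>I. \<Sum>j\<in>I. \<Sum>\<^sub>\<infinity>k\<in>carrier H. (cmod (coord (T (basis i)) (k, j)))\<^sup>2)"
    by (intro sum.cong refl norm_square_supported sup(1))
  also have "\<dots> = (\<Sum>i\<in>I. \<Sum>j\<in>I. \<Sum>\<^sub>\<infinity>k\<in>carrier H. (cmod (coord (adjoint T (basis j)) (inv k, i)))\<^sup>2)"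
    by (intro sum.cong refl infsum_cong) (simp add: coord_adjoint_basis[OF T])
  also have "\<dots> = (\<Sum>i\<in>I. \<Sum>j\<in>I. \<Sum>\<^sub>\<infinity>k\<in>carrier H. (cmod (coord (adjoint T (basis j)) (k, i)))\<^sup>2)"
  proof (intro sum.cong refl)
    fix i j
    have "bij_betw (\<lambda>k. inv k) (carrier H) (carrier H)"
      by (rule bij_betw_byWitness[where f' = "\<lambda>k. inv k"]) auto
    from infsum_reindex_bij_betw[OF this, of "\<lambda>k. (cmod (coord (adjoint T (basis j)) (k, i)))\<^sup>2"]
    show "(\<Sum>\<^sub>\<infinity>k\<in>carrier H. (cmod (coord (adjoint T (basis j)) (inv k, i)))\<^sup>2) =
        (\<Sum>\<^sub>\<infinity>k\<in>carrier H. (cmod (coord (adjoint T (basis j)) (k, i)))\<^sup>2)" .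
  qed
  also have "\<dots> = (\<Sum>j\<in>I. \<Sum>i\<in>I. \<Sum>\<^sub>\<infinity>k\<in>carrier H. (cmod (coord (adjoint T (basis j)) (k, i)))\<^sup>2)"
    by (rule sum.swap)
  also have "\<dots> = (\<Sum>j\<in>I. (norm (adjoint T (basis j)))\<^sup>2)"
    by (intro sum.cong refl norm_square_supported[symmetric] sup(2))
  finally show ?thesis .
qed

sublocale traced_commutant symmetries I basis
proof (rule traced_commutant.intro)
  show "inner (basis i) (basis i) = 1" for i by (simp add: inner_delta coord_delta)
qed (fact finite_index symmetries_bounded_linear symmetries_adjoint norm_trace_basis)+

end

section \<open>Elements of the group von Neumann algebra\<close>

lemma ell2_iff:
  "f \<in> ell2 A \<longleftrightarrow> (\<forall>x. x \<notin> A \<longrightarrow> f x = 0) \<and> (\<lambda>x. (cmod (f x))\<^sup>2) summable_on UNIV"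
proof -
  have "(\<lambda>x. (cmod (f x))\<^sup>2) summable_on A \<longleftrightarrow> (\<lambda>x. (cmod (f x))\<^sup>2) summable_on UNIV"
    if "\<forall>x. x \<notin> A \<longrightarrow> f x = 0"
    by (rule summable_on_cong_neutral) (use that in auto)
  then show ?thesis by (auto simp: ell2_def)
qed

lemma ell2_outside: "f \<in> ell2 A \<Longrightarrow> x \<notin> A \<Longrightarrow> f x = 0"
  by (simp add: ell2_def)

lemma coord_Abs_l2 [simp]: "f \<in> ell2 A \<Longrightarrow> coord (Abs_l2 f) = f"
  by (rule Abs_l2_inverse) (simp add: ell2_iff)

lemma coord_in_ell2: "(\<And>x. x \<notin> A \<Longrightarrow> coord F x = 0) \<Longrightarrow> coord F \<in> ell2 A"
  by (simp add: ell2_iff coord_summable)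

lemma ell2_lincomb:
  assumes "f \<in> ell2 A" "g \<in> ell2 A"
  shows "(\<lambda>x. a * f x + b * g x) \<in> ell2 A"
  using assms by (auto simp: ell2_iff intro!: square_summable_add square_summable_mult)

lemma ell2_scale: "f \<in> ell2 A \<Longrightarrow> (\<lambda>x. a * f x) \<in> ell2 A"
  using ell2_lincomb[of f A f a 0] by simp

lemma ell2_diff: "f \<in> ell2 A \<Longrightarrow> g \<in> ell2 A \<Longrightarrow> (\<lambda>x. f x - g x) \<in> ell2 A"
  using ell2_lincomb[of f A g 1 "-1"] by simp

lemma ell2_zero: "(\<lambda>x. 0) \<in> ell2 A"
  by (simp add: ell2_def)

lemma ell2_norm_eq:
  assumes "f \<in> ell2 A"
  shows "ell2_norm A f = norm (Abs_l2 f)"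
proof -
  have "(norm (Abs_l2 f))\<^sup>2 = (\<Sum>\<^sub>\<infinity>x\<in>A. (cmod (f x))\<^sup>2)"
    unfolding norm_l2_square using assms
    by (intro infsum_cong_neutral) (auto simp: ell2_outside)
  then show ?thesis unfolding ell2_norm_def by (metis norm_ge_zero real_sqrt_unique)
qed

lemma Re_ell2_inner:
  assumes f: "f \<in> ell2 A" and g: "g \<in> ell2 A"
  shows "Re (ell2_inner A f g) = inner (Abs_l2 f) (Abs_l2 g)"
proof -
  have "(\<lambda>x. (cmod (f x))\<^sup>2 + (cmod (g x))\<^sup>2) summable_on A"
    using f g by (intro summable_on_add) (auto simp: ell2_def)
  then have "(\<lambda>x. norm (f x * cnj (g x))) summable_on A"
  proof (rule summable_on_comparison_test)
    fix x
    show "norm (f x * cnj (g x)) \<le> (cmod (f x))\<^sup>2 + (cmod (g x))\<^sup>2"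
      using zero_le_power2[of "cmod (f x) - cmod (g x)"]
        zero_le_power2[of "cmod (f x)"] zero_le_power2[of "cmod (g x)"]
      unfolding power2_diff norm_mult complex_mod_cnj by linarith
  qed auto
  then have sm: "(\<lambda>x. f x * cnj (g x)) summable_on A" by (rule abs_summable_summable)
  have "Re (ell2_inner A f g) = (\<Sum>\<^sub>\<infinity>x\<in>A. Re (f x * cnj (g x)))"
    unfolding ell2_inner_def by (rule infsum_Re[OF sm, symmetric])
  also have "\<dots> = inner (Abs_l2 f) (Abs_l2 g)"
    unfolding inner_l2_def using f g
    by (intro infsum_cong_neutral) (auto simp: ell2_outside inner_complex_def)
  finally show ?thesis .
qed

lemma ell2_inner_scale_right: "ell2_inner A f (\<lambda>x. c * g x) = cnj c * ell2_inner A f g"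
  unfolding ell2_inner_def
  by (subst infsum_cmult_right'[symmetric]) (simp add: mult_ac)

lemma ell2_inner_delta: "a \<in> A \<Longrightarrow> ell2_inner A f (ell2_delta a) = f a"
proof -
  assume "a \<in> A"
  then have "ell2_inner A f (ell2_delta a) = (\<Sum>\<^sub>\<infinity>x\<in>{a}. f x * cnj (ell2_delta a x))"
    unfolding ell2_inner_def by (intro infsum_cong_neutral) (auto simp: ell2_delta_def)
  then show ?thesis by (simp add: ell2_delta_def)
qed

lemma ell2_delta_in_ell2: "a \<in> A \<Longrightarrow> ell2_delta a \<in> ell2 A"
  unfolding delta.rep_eq[symmetric] by (rule coord_in_ell2) (auto simp: coord_delta)

lemma Abs_l2_delta: "Abs_l2 (ell2_delta a) = delta a"
  by (metis coord_inverse delta.rep_eq)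

text \<open>
  Orthogonality in the definition of the dimension is complex. For a subspace closed under complex
  scalars it amounts to orthogonality for the real inner product, since the imaginary part of
  \<open>\<langle>f, v\<rangle>\<close> is the real part of \<open>\<langle>f, \<i> v\<rangle>\<close>.
\<close>

lemma vN_dim_eqI:
  fixes H (structure)
  assumes one: "\<one> \<in> carrier H" and sub: "V \<subseteq> ell2 (carrier H)"
    and diff: "\<And>f g. f \<in> V \<Longrightarrow> g \<in> V \<Longrightarrow> (\<lambda>x. f x - g x) \<in> V"
    and scale: "\<And>c f. f \<in> V \<Longrightarrow> (\<lambda>x. c * f x) \<in> V"
    and g: "g \<in> V" and orth: "\<And>v. v \<in> V \<Longrightarrow> inner (delta \<one> - Abs_l2 g) (Abs_l2 v) = 0"
  shows "vN_dim H V = Re (g \<one>)"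
proof -
  let ?C = "carrier H" and ?d = "ell2_delta \<one>"
  have d: "?d \<in> ell2 ?C" by (rule ell2_delta_in_ell2[OF one])
  have Vmem: "f \<in> ell2 ?C" if "f \<in> V" for f using sub that by blast
  have Re: "Re (ell2_inner ?C (\<lambda>x. ?d x - h x) v) = inner (delta \<one> - Abs_l2 h) (Abs_l2 v)"
    if "h \<in> V" "v \<in> V" for h v
  proof -
    have "Abs_l2 (\<lambda>x. ?d x - h x) = delta \<one> - Abs_l2 h"
      by (rule l2_eqI) (simp add: coord_Abs_l2[OF ell2_diff[OF d Vmem[OF that(1)]]]
          coord_Abs_l2[OF Vmem[OF that(1)]] delta.rep_eq)
    then show ?thesis using Re_ell2_inner[OF ell2_diff[OF d Vmem[OF that(1)]] Vmem[OF that(2)]] by simp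
  qed
  have orth': "ell2_inner ?C (\<lambda>x. ?d x - g x) v = 0" if v: "v \<in> V" for v
  proof -
    have "Re (ell2_inner ?C (\<lambda>x. ?d x - g x) v) = 0" unfolding Re[OF g v] by (rule orth[OF v])
    moreover have "Re (ell2_inner ?C (\<lambda>x. ?d x - g x) (\<lambda>x. \<i> * v x)) = 0"
      unfolding Re[OF g scale[OF v]] by (rule orth[OF scale[OF v]])
    ultimately show ?thesis by (simp add: ell2_inner_scale_right complex_eq_iff)
  qed
  have uniq: "h = g" if "h \<in> V" and h: "\<forall>v\<in>V. ell2_inner ?C (\<lambda>x. ?d x - h x) v = 0" for h
  proof -
    let ?w = "\<lambda>x. h x - g x"
    have w: "?w \<in> V" by (rule diff[OF \<open>h \<in> V\<close> g])
    have "inner (delta \<one> - Abs_l2 h) (Abs_l2 ?w) = 0"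
      using h w Re[OF \<open>h \<in> V\<close> w] by simp
    then have "inner (Abs_l2 h - Abs_l2 g) (Abs_l2 ?w) = 0"
      using orth[OF w] by (simp add: inner_diff_left)
    moreover have "Abs_l2 ?w = Abs_l2 h - Abs_l2 g"
      by (rule l2_eqI) (simp add: coord_Abs_l2[OF Vmem[OF w]] coord_Abs_l2[OF Vmem[OF \<open>h \<in> V\<close>]]
          coord_Abs_l2[OF Vmem[OF g]])
    ultimately have "Abs_l2 h = Abs_l2 g" by simp
    then show ?thesis by (metis coord_Abs_l2 Vmem \<open>h \<in> V\<close> g)
  qed
  have "ell2_proj ?C V ?d = g"
    unfolding ell2_proj_def ell2_restrict_def using d
    by (simp, intro the_equality) (use g orth' uniq in blast)+
  then show ?thesis unfolding vN_dim_def vN_trace_def by (simp add: ell2_inner_delta[OF one])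
qed

context group
begin

lemma group_vN_carrierD:
  assumes "a \<in> carrier (group_vN G)"
  shows "f \<in> ell2 (carrier G) \<Longrightarrow> a f \<in> ell2 (carrier G)"
    and "f \<in> ell2 (carrier G) \<Longrightarrow> g \<in> ell2 (carrier G) \<Longrightarrow>
      a (\<lambda>x. c * f x + d * g x) = (\<lambda>x. c * a f x + d * a g x)"
    and "\<exists>K\<ge>0. \<forall>f\<in>ell2 (carrier G). norm (Abs_l2 (a f)) \<le> K * norm (Abs_l2 f)"
    and "f \<notin> ell2 (carrier G) \<Longrightarrow> a f = (\<lambda>x. 0)"
    and "h \<in> carrier G \<Longrightarrow> f \<in> ell2 (carrier G) \<Longrightarrow>
      a (right_trans G h f) = right_trans G h (a f)"
proof -
  note * = assms[unfolded group_vN_def ell2_bounded_op_def, simplified]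
  show mem: "a f \<in> ell2 (carrier G)" if "f \<in> ell2 (carrier G)" for f using * that by blast
  show "a (\<lambda>x. c * f x + d * g x) = (\<lambda>x. c * a f x + d * a g x)"
    if "f \<in> ell2 (carrier G)" "g \<in> ell2 (carrier G)" using * that by blast
  show "a f = (\<lambda>x. 0)" if "f \<notin> ell2 (carrier G)" using * that by blast
  show "a (right_trans G h f) = right_trans G h (a f)"
    if "h \<in> carrier G" "f \<in> ell2 (carrier G)" using * that by blast
  obtain K where K: "\<And>f. f \<in> ell2 (carrier G) \<Longrightarrow>
      ell2_norm (carrier G) (a f) \<le> K * ell2_norm (carrier G) f"
    using * by blast
  have "norm (Abs_l2 (a f)) \<le> \<bar>K\<bar> * norm (Abs_l2 f)" if "f \<in> ell2 (carrier G)" for f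
  proof -
    have "norm (Abs_l2 (a f)) \<le> K * norm (Abs_l2 f)"
      using K[OF that] by (simp add: ell2_norm_eq mem that)
    also have "\<dots> \<le> \<bar>K\<bar> * norm (Abs_l2 f)" by (rule mult_right_mono) auto
    finally show ?thesis .
  qed
  then show "\<exists>K\<ge>0. \<forall>f\<in>ell2 (carrier G). norm (Abs_l2 (a f)) \<le> K * norm (Abs_l2 f)"
    by (intro exI[of _ "\<bar>K\<bar>"]) auto
qed

lemma group_vN_carrierI:
  assumes "\<And>f. f \<in> ell2 (carrier G) \<Longrightarrow> a f \<in> ell2 (carrier G)"
    and "\<And>f g c d. f \<in> ell2 (carrier G) \<Longrightarrow> g \<in> ell2 (carrier G) \<Longrightarrow>
      a (\<lambda>x. c * f x + d * g x) = (\<lambda>x. c * a f x + d * a g x)"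
    and "\<And>f. f \<in> ell2 (carrier G) \<Longrightarrow> norm (Abs_l2 (a f)) \<le> K * norm (Abs_l2 f)"
    and "\<And>f. f \<notin> ell2 (carrier G) \<Longrightarrow> a f = (\<lambda>x. 0)"
    and "\<And>h f. h \<in> carrier G \<Longrightarrow> f \<in> ell2 (carrier G) \<Longrightarrow>
      a (right_trans G h f) = right_trans G h (a f)"
  shows "a \<in> carrier (group_vN G)"
proof -
  have "\<forall>f\<in>ell2 (carrier G). ell2_norm (carrier G) (a f) \<le> K * ell2_norm (carrier G) f"
    using assms(1,3) by (simp add: ell2_norm_eq)
  then show ?thesis
    unfolding group_vN_def ell2_bounded_op_def using assms(1,2,4,5) by simp blast
qed

lemma group_vN_at_zero: "a \<in> carrier (group_vN G) \<Longrightarrow> a (\<lambda>x. 0) = (\<lambda>x. 0)"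
  using group_vN_carrierD(2)[OF _ ell2_zero ell2_zero, of a 0 0] by simp

lemma vN_dim_kernel_eqI:
  assumes a: "a \<in> carrier (group_vN G)" and p: "p \<in> ell2_kernel (carrier G) a"
    and orth: "\<And>v. v \<in> ell2_kernel (carrier G) a \<Longrightarrow> inner (delta \<one> - Abs_l2 p) (Abs_l2 v) = 0"
  shows "vN_dim G (ell2_kernel (carrier G) a) = Re (p \<one>)"
proof (rule vN_dim_eqI[where g = p, OF one_closed])
  note A = group_vN_carrierD[OF a]
  show "ell2_kernel (carrier G) a \<subseteq> ell2 (carrier G)" by (auto simp: ell2_kernel_def)
  show "(\<lambda>x. f x - g x) \<in> ell2_kernel (carrier G) a"
    if "f \<in> ell2_kernel (carrier G) a" "g \<in> ell2_kernel (carrier G) a" for f g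
    using that A(2)[of f g 1 "- 1"] by (simp add: ell2_kernel_def ell2_diff)
  show "(\<lambda>x. c * f x) \<in> ell2_kernel (carrier G) a"
    if "f \<in> ell2_kernel (carrier G) a" for f c
    using that A(2)[of f f c 0] by (simp add: ell2_kernel_def ell2_scale)
qed (fact p orth)+

lemma right_trans_in_ell2:
  assumes h: "h \<in> carrier G" and f: "f \<in> ell2 (carrier G)"
  shows "right_trans G h f \<in> ell2 (carrier G)"
proof -
  have "inj_on (\<lambda>x. x \<otimes> inv h) (carrier G)" using h by (auto simp: inj_on_def)
  then have "coord (pull (carrier G) (\<lambda>x. x \<otimes> inv h) (Abs_l2 f)) = right_trans G h f"
    by (auto simp: coord_pull coord_Abs_l2[OF f] right_trans_def fun_eq_iff)
  moreover have "right_trans G h f x = 0" if "x \<notin> carrier G" for x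
    using that by (simp add: right_trans_def)
  ultimately show ?thesis by (metis coord_in_ell2)
qed

lemma group_vN_zero: "(\<lambda>f x. 0) \<in> carrier (group_vN G)"
  by (rule group_vN_carrierI[where K = 0])
    (auto simp: ell2_zero right_trans_def ell2_norm_eq[OF ell2_zero, of "carrier G", symmetric] ell2_norm_def)

lemma group_vN_comp:
  assumes a: "a \<in> carrier (group_vN G)" and b: "b \<in> carrier (group_vN G)"
  shows "a \<circ> b \<in> carrier (group_vN G)"
proof -
  note A = group_vN_carrierD[OF a] and B = group_vN_carrierD[OF b]
  obtain K L where K: "K \<ge> 0" "\<And>f. f \<in> ell2 (carrier G) \<Longrightarrow> norm (Abs_l2 (a f)) \<le> K * norm (Abs_l2 f)"
    and L: "\<And>f. f \<in> ell2 (carrier G) \<Longrightarrow> norm (Abs_l2 (b f)) \<le> L * norm (Abs_l2 f)"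
    using A(3) B(3) by blast
  show ?thesis
  proof (rule group_vN_carrierI[where K = "K * L"])
    fix f assume f: "f \<in> ell2 (carrier G)"
    have "norm (Abs_l2 (a (b f))) \<le> K * norm (Abs_l2 (b f))" by (rule K(2)[OF B(1)[OF f]])
    also have "\<dots> \<le> K * (L * norm (Abs_l2 f))" by (rule mult_left_mono[OF L[OF f] K(1)])
    finally show "norm (Abs_l2 ((a \<circ> b) f)) \<le> K * L * norm (Abs_l2 f)" by (simp add: mult_ac)
  next
    fix f assume "f \<notin> ell2 (carrier G)"
    then show "(a \<circ> b) f = (\<lambda>x. 0)" using B(4) by (simp add: group_vN_at_zero[OF a])
  qed (simp_all add: A(1,2,5) B(1,2,5))
qed

lemma group_vN_add:
  assumes a: "a \<in> carrier (group_vN G)" and b: "b \<in> carrier (group_vN G)"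
  shows "(\<lambda>f x. a f x + b f x) \<in> carrier (group_vN G)"
proof -
  note A = group_vN_carrierD[OF a] and B = group_vN_carrierD[OF b]
  obtain K L where K: "\<And>f. f \<in> ell2 (carrier G) \<Longrightarrow> norm (Abs_l2 (a f)) \<le> K * norm (Abs_l2 f)"
    and L: "\<And>f. f \<in> ell2 (carrier G) \<Longrightarrow> norm (Abs_l2 (b f)) \<le> L * norm (Abs_l2 f)"
    using A(3) B(3) by blast
  have mem: "(\<lambda>x. a f x + b f x) \<in> ell2 (carrier G)" if "f \<in> ell2 (carrier G)" for f
    using ell2_lincomb[OF A(1)[OF that] B(1)[OF that], of 1 1] by simp
  show ?thesis
  proof (rule group_vN_carrierI[where K = "K + L"])
    fix f assume f: "f \<in> ell2 (carrier G)"
    have "Abs_l2 (\<lambda>x. a f x + b f x) = Abs_l2 (a f) + Abs_l2 (b f)"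
      by (rule l2_eqI) (simp add: coord_Abs_l2[OF mem[OF f]] coord_Abs_l2[OF A(1)[OF f]]
          coord_Abs_l2[OF B(1)[OF f]])
    then have "norm (Abs_l2 (\<lambda>x. a f x + b f x)) \<le> norm (Abs_l2 (a f)) + norm (Abs_l2 (b f))"
      using norm_triangle_ineq by simp
    also have "\<dots> \<le> (K + L) * norm (Abs_l2 f)" using K[OF f] L[OF f] by (simp add: distrib_right)
    finally show "norm (Abs_l2 (\<lambda>x. a f x + b f x)) \<le> (K + L) * norm (Abs_l2 f)" .
  next
    fix h f assume "h \<in> carrier G" "f \<in> ell2 (carrier G)"
    then show "(\<lambda>x. a (right_trans G h f) x + b (right_trans G h f) x) =
        right_trans G h (\<lambda>x. a f x + b f x)"
      by (simp only: A(5) B(5)) (simp add: right_trans_def fun_eq_iff)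
  qed (auto simp: mem A(2,4) B(2,4) algebra_simps)
qed

end

section \<open>Matrices over the group von Neumann algebra\<close>

context l2_copies
begin

definition up :: "'i \<Rightarrow> 'a l2 \<Rightarrow> ('a \<times> 'i) l2" where
  "up i = pull (carrier H \<times> {i}) fst"

definition down :: "'i \<Rightarrow> ('a \<times> 'i) l2 \<Rightarrow> 'a l2" where
  "down i = pull (carrier H) (\<lambda>x. (x, i))"

lemma inj_up: "inj_on fst (carrier H \<times> {i :: 'i})"
  and inj_down: "inj_on (\<lambda>x. (x, i :: 'i)) (carrier H)"
  by (auto simp: inj_on_def)

lemma coord_up: "coord (up i f) (x, l) = (if x \<in> carrier H \<and> l = i then coord f x else 0)"
  by (auto simp: up_def coord_pull[OF inj_up])

lemma coord_down: "coord (down i F) x = (if x \<in> carrier H then coord F (x, i) else 0)"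
  by (simp add: down_def coord_pull[OF inj_down])

lemma inner_up: "inner (up i f) F = inner f (down i F)"
  unfolding up_def down_def by (rule inner_pull[OF inj_up]) auto

lemmas bounded_linear_down = bounded_linear_pull[OF inj_down, folded down_def]
  and norm_up_le = norm_pull_le[OF inj_up, folded up_def]
  and norm_down_le = norm_pull_le[OF inj_down, folded down_def]

lemma down_in_ell2: "coord (down i F) \<in> ell2 (carrier H)"
  by (rule coord_in_ell2) (simp add: coord_down)

lemma coord_down_rshift:
  "h \<in> carrier H \<Longrightarrow> i \<in> I \<Longrightarrow> coord (down i (rshift h F)) = right_trans H h (coord (down i F))"
  by (auto simp: fun_eq_iff coord_down coord_rshift right_trans_def)

lemma up_right_trans:
  assumes "h \<in> carrier H" "i \<in> I" "f \<in> ell2 (carrier H)"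
  shows "up i (Abs_l2 (right_trans H h f)) = rshift h (up i (Abs_l2 f))"
proof (rule l2_eqI)
  fix y :: "'a \<times> 'i"
  obtain x l where y: "y = (x, l)" by (cases y)
  show "coord (up i (Abs_l2 (right_trans H h f))) y = coord (rshift h (up i (Abs_l2 f))) y"
    unfolding y coord_up coord_rshift[OF assms(1)]
      coord_Abs_l2[OF right_trans_in_ell2[OF assms(1,3)]] coord_Abs_l2[OF assms(3)]
    using assms(1,2) by (simp add: right_trans_def)
qed

text \<open>
  The matrix whose only non-zero entry is \<open>a\<close>, in row \<open>i\<close> and column \<open>j\<close>.
\<close>

definition block :: "'a vec_op \<Rightarrow> 'i \<Rightarrow> 'i \<Rightarrow> ('a \<times> 'i) l2 \<Rightarrow> ('a \<times> 'i) l2" where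
  "block a i j F = up i (Abs_l2 (a (coord (down j F))))"

lemma coord_block:
  assumes "a \<in> carrier (group_vN H)"
  shows "coord (block a i j F) (x, l) = (if x \<in> carrier H \<and> l = i then a (coord (down j F)) x else 0)"
  by (simp add: block_def coord_up coord_Abs_l2[OF group_vN_carrierD(1)[OF assms down_in_ell2]])

lemma block_M:
  assumes a: "a \<in> carrier (group_vN H)" and ij: "i \<in> I" "j \<in> I"
  shows "block a i j \<in> M"
proof -
  note A = group_vN_carrierD[OF a]
  have lin: "coord (block a i j F) (x, l) = c * coord (block a i j F1) (x, l) + d * coord (block a i j F2) (x, l)"
    if "\<And>y. coord F y = c * coord F1 y + d * coord F2 y" for F F1 F2 c d x l
  proof -
    have "coord (down j F) = (\<lambda>x. c * coord (down j F1) x + d * coord (down j F2) x)"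
      by (auto simp: coord_down that)
    then have "a (coord (down j F)) = (\<lambda>x. c * a (coord (down j F1)) x + d * a (coord (down j F2)) x)"
      using A(2)[OF down_in_ell2 down_in_ell2] by simp
    then show ?thesis by (simp add: coord_block[OF a])
  qed
  obtain K where K: "K \<ge> 0" "\<And>f. f \<in> ell2 (carrier H) \<Longrightarrow> norm (Abs_l2 (a f)) \<le> K * norm (Abs_l2 f)"
    using A(3) by blast
  have bl: "bounded_linear (block a i j)"
  proof (rule bounded_linear_intro[where K = K])
    show "block a i j (F1 + F2) = block a i j F1 + block a i j F2" for F1 F2
      by (rule l2_eqI) (use lin[of "F1 + F2" 1 F1 1 F2] in auto)
    show "block a i j (r *\<^sub>R F) = r *\<^sub>R block a i j F" for r F
      by (rule l2_eqI) (use lin[of "r *\<^sub>R F" r F 0 F] in auto)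
    fix F
    have "norm (block a i j F) \<le> norm (Abs_l2 (a (coord (down j F))))"
      unfolding block_def by (rule norm_up_le)
    also have "\<dots> \<le> K * norm (down j F)" using K(2)[OF down_in_ell2] by (simp add: coord_inverse)
    also have "\<dots> \<le> K * norm F" by (rule mult_left_mono[OF norm_down_le K(1)])
    finally show "norm (block a i j F) \<le> norm F * K" by (simp add: mult.commute)
  qed
  have "block a i j (rshift h F) = rshift h (block a i j F)" if "h \<in> carrier H" for h F
    unfolding block_def coord_down_rshift[OF that ij(2)] A(5)[OF that down_in_ell2]
    by (rule up_right_trans[OF that ij(1) A(1)[OF down_in_ell2]])
  moreover have "block a i j (cscale c F) = cscale c (block a i j F)" for c F
    by (rule l2_eqI) (use lin[of "cscale c F" c F 0 F] in auto)
  ultimately show ?thesis using bl by (auto simp: commutant_def symmetries_def)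
qed

definition entry :: "(('a \<times> 'i) l2 \<Rightarrow> ('a \<times> 'i) l2) \<Rightarrow> 'i \<Rightarrow> 'i \<Rightarrow> 'a vec_op" where
  "entry T i j = ell2_restrict (carrier H) (\<lambda>f. coord (down i (T (up j (Abs_l2 f)))))"

lemma entry_apply: "f \<in> ell2 (carrier H) \<Longrightarrow> entry T i j f = coord (down i (T (up j (Abs_l2 f))))"
  by (simp add: entry_def ell2_restrict_def)

lemma entry_carrier:
  assumes T: "T \<in> M" and ij: "i \<in> I" "j \<in> I"
  shows "entry T i j \<in> carrier (group_vN H)"
proof -
  note bl = commutant_bounded_linear[OF T]
  obtain K where K: "\<And>F. norm (T F) \<le> K * norm F" "K > 0"
    using bounded_linear.pos_bounded[OF bl] by (auto simp: mult.commute)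
  show ?thesis
  proof (rule group_vN_carrierI[where K = K])
    fix f assume f: "f \<in> ell2 (carrier H)"
    show "entry T i j f \<in> ell2 (carrier H)" unfolding entry_apply[OF f] by (rule down_in_ell2)
    have "norm (down i (T (up j (Abs_l2 f)))) \<le> norm (T (up j (Abs_l2 f)))" by (rule norm_down_le)
    also have "\<dots> \<le> K * norm (up j (Abs_l2 f))" by (rule K(1))
    also have "\<dots> \<le> K * norm (Abs_l2 f)" using K(2) norm_up_le by (intro mult_left_mono) auto
    finally show "norm (Abs_l2 (entry T i j f)) \<le> K * norm (Abs_l2 f)"
      unfolding entry_apply[OF f] coord_inverse .
    fix h assume h: "h \<in> carrier H"
    show "entry T i j (right_trans H h f) = right_trans H h (entry T i j f)"
      unfolding entry_apply[OF f] entry_apply[OF right_trans_in_ell2[OF h f]]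
        up_right_trans[OF h ij(2) f] commutant_rshift[OF T h] by (rule coord_down_rshift[OF h ij(1)])
  next
    fix f g c d assume f: "f \<in> ell2 (carrier H)" and g: "g \<in> ell2 (carrier H)"
    note fg = ell2_lincomb[OF f g, of c d]
    have "up j (Abs_l2 (\<lambda>x. c * f x + d * g x)) =
        cscale c (up j (Abs_l2 f)) + cscale d (up j (Abs_l2 g))"
    proof (rule l2_eqI)
      fix y :: "'a \<times> 'i"
      obtain x l where y: "y = (x, l)" by (cases y)
      show "coord (up j (Abs_l2 (\<lambda>x. c * f x + d * g x))) y =
        coord (cscale c (up j (Abs_l2 f)) + cscale d (up j (Abs_l2 g))) y"
        by (simp add: y coord_up coord_Abs_l2[OF f] coord_Abs_l2[OF g] coord_Abs_l2[OF fg])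
    qed
    then have "T (up j (Abs_l2 (\<lambda>x. c * f x + d * g x))) =
        cscale c (T (up j (Abs_l2 f))) + cscale d (T (up j (Abs_l2 g)))"
      by (simp add: linear_simps[OF bl] commutant_cscale[OF T])
    then show "entry T i j (\<lambda>x. c * f x + d * g x) = (\<lambda>x. c * entry T i j f x + d * entry T i j g x)"
      unfolding entry_apply[OF f] entry_apply[OF g] entry_apply[OF fg]
      by (auto simp: fun_eq_iff coord_down)
  qed (simp add: entry_def ell2_restrict_def)
qed

definition supported :: "'i set \<Rightarrow> ('a \<times> 'i) l2 set" where
  "supported J = {F. \<forall>x l. x \<notin> carrier H \<or> l \<notin> J \<longrightarrow> coord F (x, l) = 0}"

definition cut :: "'i set \<Rightarrow> ('a \<times> 'i) l2 \<Rightarrow> ('a \<times> 'i) l2" where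
  "cut J = pull (carrier H \<times> J) (\<lambda>y. y)"

lemma coord_cut: "coord (cut J F) (x, l) = (if x \<in> carrier H \<and> l \<in> J then coord F (x, l) else 0)"
  by (simp add: cut_def coord_pull inj_on_def)

lemma inner_cut: "inner (cut J F) F' = inner F (cut J F')"
  unfolding cut_def by (rule inner_pull) auto

lemma cut_supported: "F \<in> supported J \<Longrightarrow> cut J F = F"
  by (rule l2_eqI) (auto simp: supported_def coord_cut split: prod.splits)

lemma cut_in_supported: "cut J F \<in> supported J"
  by (simp add: supported_def coord_cut)

lemma cut_M:
  assumes "J \<subseteq> I"
  shows "cut J \<in> M"
proof -
  have "bounded_linear (cut J)" unfolding cut_def by (rule bounded_linear_pull) simp
  moreover have "cut J (rshift h F) = rshift h (cut J F)" if "h \<in> carrier H" for h F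
    by (rule l2_eqI) (use that assms in \<open>auto simp: coord_cut coord_rshift\<close>)
  moreover have "cut J (cscale c F) = cscale c (cut J F)" for c F
    by (rule l2_eqI) (auto simp: coord_cut)
  ultimately show ?thesis by (auto simp: commutant_def symmetries_def)
qed

lemma is_proj_cut: "is_proj (cut J) (supported J)"
proof -
  have "inner (F - cut J F) v = 0" if "v \<in> supported J" for F v
    using inner_cut[of J F v] by (simp add: inner_diff_left cut_supported[OF that])
  then show ?thesis by (auto simp: is_proj_def cut_in_supported)
qed

lemma supported_kernels:
  assumes "J \<subseteq> I"
  shows "supported J \<in> kernels"
proof (rule kernelsI)
  show "(\<lambda>F. F - cut J F) \<in> M" by (rule M_diff[OF commutant_id cut_M[OF assms]])
  show "supported J = {F. F - cut J F = 0}"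
    using cut_supported cut_in_supported[of J] by (auto simp del: right_minus_eq) (metis right_minus_eq)
qed

lemma vdim_supported:
  assumes "J \<subseteq> I"
  shows "vdim (supported J) = real (card J)"
proof -
  have "vdim (supported J) = tr (cut J)"
    by (rule vdim_eq_tr[OF is_proj_cut kernels_subspace[OF supported_kernels[OF assms]]])
  also have "\<dots> = (\<Sum>i\<in>I. if i \<in> J then 1 else 0)"
    unfolding tr_def by (intro sum.cong refl) (simp add: inner_delta coord_cut coord_delta)
  also have "\<dots> = real (card (I \<inter> J))" by (simp add: sum.If_cases[OF finite_index])
  finally show ?thesis using assms by (simp add: Int_absorb1)
qed

lemma down_supported:
  "F \<in> supported J \<Longrightarrow> l \<notin> J \<Longrightarrow> coord (down l F) = (\<lambda>x. 0)"
  by (auto simp: coord_down supported_def)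

definition nullspace :: "'i \<Rightarrow> 'a vec_op \<Rightarrow> ('a \<times> 'i) l2 set" where
  "nullspace i a = {F \<in> supported {i}. a (coord (down i F)) = (\<lambda>x. 0)}"

lemma block_eq_0_iff:
  assumes a: "a \<in> carrier (group_vN H)"
  shows "block a i j F = 0 \<longleftrightarrow> a (coord (down j F)) = (\<lambda>x. 0)"
proof
  assume z: "block a i j F = 0"
  have "a (coord (down j F)) x = 0" for x
    using coord_block[OF a, of i j F x i] ell2_outside[OF group_vN_carrierD(1)[OF a down_in_ell2]]
    by (cases "x \<in> carrier H") (auto simp: z)
  then show "a (coord (down j F)) = (\<lambda>x. 0)" by blast
next
  assume "a (coord (down j F)) = (\<lambda>x. 0)"
  then show "block a i j F = 0" by (intro l2_eqI) (auto simp: coord_block[OF a] split: prod.splits)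
qed

lemma nullspace_kernels:
  assumes a: "a \<in> carrier (group_vN H)" and i: "i \<in> I"
  shows "nullspace i a \<in> kernels"
proof -
  have "nullspace i a = supported {i} \<inter> {F. block a i i F = 0}"
    by (auto simp: nullspace_def block_eq_0_iff[OF a])
  then show ?thesis
    using kernels_Int[OF supported_kernels kernelsI[OF block_M[OF a i i] refl]] i by simp
qed

abbreviation nullity :: "'a vec_op \<Rightarrow> real" where
  "nullity a \<equiv> vN_dim H (ell2_kernel (carrier H) a)"

text \<open>
  The projection of a basis vector \<open>basis l\<close> to a subspace of the \<open>i\<close>-th copy lies in that copy, so
  only \<open>l = i\<close> contributes to the trace. That term is the trace in \<open>\<ell>\<^sup>2H\<close>.
\<close>

lemma kernel_delta_proj:
  assumes a: "a \<in> carrier (group_vN H)" and i: "i \<in> I"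
  shows "\<exists>p \<in> ell2_kernel (carrier H) a. vdim (nullspace i a) = Re (p \<one>) \<and>
    (\<forall>v \<in> ell2_kernel (carrier H) a. inner (delta \<one> - Abs_l2 p) (Abs_l2 v) = 0)"
proof -
  note ker = nullspace_kernels[OF a i]
  obtain P where P: "P \<in> M" "is_proj P (nullspace i a)" using kernels_proj[OF ker] by blast
  have Ps: "P F \<in> nullspace i a" for F by (rule is_projD(1)[OF P(2)])
  define p where "p = coord (down i (P (basis i)))"
  have "vdim (nullspace i a) = tr P" by (rule vdim_eq_tr[OF P(2) kernels_subspace[OF ker]])
  also have "\<dots> = (\<Sum>l\<in>I. if l = i then Re (coord (P (basis i)) (\<one>, i)) else 0)"
    unfolding tr_def
  proof (intro sum.cong refl)
    fix l
    show "inner (P (basis l)) (basis l) = (if l = i then Re (coord (P (basis i)) (\<one>, i)) else 0)"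
      using Ps[of "basis l"] by (auto simp: inner_delta nullspace_def supported_def)
  qed
  also have "\<dots> = Re (coord (P (basis i)) (\<one>, i))" using i finite_index by simp
  finally have 1: "vdim (nullspace i a) = Re (p \<one>)" by (simp add: p_def coord_down)
  have 2: "p \<in> ell2_kernel (carrier H) a"
    using Ps[of "basis i"] down_in_ell2 by (simp add: p_def ell2_kernel_def nullspace_def)
  have "inner (delta \<one> - Abs_l2 p) (Abs_l2 v) = 0" if "v \<in> ell2_kernel (carrier H) a" for v
  proof -
    have v: "v \<in> ell2 (carrier H)" "a v = (\<lambda>x. 0)" using that by (auto simp: ell2_kernel_def)
    have du: "coord (down i (up i (Abs_l2 v))) = v"
      by (auto simp: fun_eq_iff coord_down coord_up coord_Abs_l2[OF v(1)] ell2_outside[OF v(1)])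
    have uv: "up i (Abs_l2 v) \<in> nullspace i a"
      unfolding nullspace_def by (auto simp: supported_def coord_up du v(2))
    have "down i (basis i) = delta \<one>"
      by (rule l2_eqI) (auto simp: coord_down coord_delta)
    then have "inner (delta \<one> - Abs_l2 p) (Abs_l2 v) =
        inner (down i (basis i - P (basis i))) (Abs_l2 v)"
      by (simp add: p_def coord_inverse linear_simps[OF bounded_linear_down])
    also have "\<dots> = inner (basis i - P (basis i)) (up i (Abs_l2 v))"
      using inner_up[of i "Abs_l2 v" "basis i - P (basis i)"] by (simp only: inner_commute)
    also have "\<dots> = 0" using is_projD(2)[OF P(2) uv, of "basis i"] by (simp only: inner_diff_left)
    finally show ?thesis .
  qed
  then show ?thesis using 1 2 by blast
qed

lemma vdim_nullspace:
  assumes a: "a \<in> carrier (group_vN H)" and i: "i \<in> I"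
  shows "vdim (nullspace i a) = nullity a"
  using kernel_delta_proj[OF a i] vN_dim_kernel_eqI[OF a] by force

lemma nullity_zero: "i \<in> I \<Longrightarrow> nullity (\<lambda>f x. 0) = 1"
proof -
  assume i: "i \<in> I"
  have "nullspace i (\<lambda>f x. 0) = supported {i}" by (auto simp: nullspace_def)
  then show ?thesis using vdim_nullspace[OF group_vN_zero i] vdim_supported[of "{i}"] i by simp
qed

lemma nullity_le_1:
  assumes "a \<in> carrier (group_vN H)" "i \<in> I"
  shows "nullity a \<le> 1"
proof -
  have "vdim (nullspace i a) \<le> vdim (supported {i})"
    using assms by (intro vdim_mono nullspace_kernels supported_kernels) (auto simp: nullspace_def)
  then show ?thesis using vdim_nullspace[OF assms] vdim_supported[of "{i}"] assms(2) by simp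
qed

text \<open>
  For the second part, \<open>b\<close> maps \<open>ker (a b)\<close> into \<open>ker a\<close>, with kernel \<open>ker b\<close>.
\<close>

lemma nullity_comp:
  assumes a: "a \<in> carrier (group_vN H)" and b: "b \<in> carrier (group_vN H)" and i: "i \<in> I"
  shows "nullity b \<le> nullity (a \<circ> b)" and "nullity (a \<circ> b) \<le> nullity a + nullity b"
proof -
  note ab = group_vN_comp[OF a b]
  note a0 = group_vN_at_zero[OF a]
  have "vdim (nullspace i b) \<le> vdim (nullspace i (a \<circ> b))"
    by (intro vdim_mono nullspace_kernels a b ab i) (auto simp: nullspace_def a0)
  then show "nullity b \<le> nullity (a \<circ> b)" by (simp only: vdim_nullspace a b ab i)
  have db: "coord (down i (block b i i F)) = b (coord (down i F))" for F
    using ell2_outside[OF group_vN_carrierD(1)[OF b down_in_ell2]]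
    by (auto simp: fun_eq_iff coord_down coord_block[OF b])
  have "vdim (nullspace i (a \<circ> b)) \<le>
      vdim {F \<in> nullspace i (a \<circ> b). block b i i F = 0} + vdim (nullspace i a)"
  proof (rule vdim_le_kernel_plus_range)
    fix F assume "F \<in> nullspace i (a \<circ> b)"
    then show "block b i i F \<in> nullspace i a"
      by (auto simp: nullspace_def supported_def db coord_block[OF b])
  qed (intro nullspace_kernels block_M a b ab i)+
  also have "{F \<in> nullspace i (a \<circ> b). block b i i F = 0} = nullspace i b"
    by (auto simp: nullspace_def block_eq_0_iff[OF b] a0)
  finally show "nullity (a \<circ> b) \<le> nullity a + nullity b"
    by (simp only: vdim_nullspace a b ab i)
qed

text \<open>
  The \<open>i\<close>-th coordinates of vectors in \<open>V\<close> are orthogonal to the kernel of the diagonal entry of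
  \<open>P\<close>: if the \<open>i\<close>-th coordinate of \<open>P w\<close> vanishes for some \<open>w\<close> in the \<open>i\<close>-th copy, then
  \<open>\<parallel>P w\<parallel>\<^sup>2 = \<langle>P w, w\<rangle> = 0\<close>. So they lie in a space of dimension one minus the nullity of that entry.
\<close>

lemma vdim_le_entry:
  assumes V: "V \<in> kernels" and P: "P \<in> M" "is_proj P V" and i: "i \<in> I"
  shows "vdim V \<le> vdim {F \<in> V. cut {i} F = 0} + (1 - nullity (entry P i i))"
proof -
  note c = entry_carrier[OF P(1) i i]
  let ?N = "nullspace i (entry P i i)"
  note N = nullspace_kernels[OF c i]
  obtain Q where Q: "Q \<in> M" "is_proj Q ?N" using kernels_proj[OF N] by blast
  note blQ = commutant_bounded_linear[OF Q(1)]
  define U where "U = supported {i} \<inter> {F. Q F = 0}"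
  have iI: "{i} \<subseteq> I" using i by simp
  have U: "U \<in> kernels" unfolding U_def
    by (rule kernels_Int[OF supported_kernels[OF iI] kernelsI[OF Q(1) refl]])
  have QN: "Q F \<in> ?N" for F by (rule is_projD(1)[OF Q(2)])
  have Qs: "Q F \<in> supported {i}" for F using QN[of F] by (simp add: nullspace_def)
  have QQ: "Q (Q F) = Q F" for F
    by (rule is_proj_apply_mem[OF Q(2) kernels_subspace[OF N] QN])
  have Qcut: "Q (cut {i} F) = Q F" for F
  proof (rule eq_if_inner_eq)
    fix z
    show "inner (Q (cut {i} F)) z = inner (Q F) z"
      unfolding is_proj_selfadjoint[OF Q(2)] inner_cut cut_supported[OF Qs] ..
  qed
  have "is_proj (\<lambda>F. cut {i} F - Q F) U"
    unfolding is_proj_def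
  proof (intro allI conjI ballI)
    fix F
    show "cut {i} F - Q F \<in> U"
      using cut_in_supported[of "{i}" F] Qs[of F]
      by (simp add: U_def linear_simps[OF blQ] Qcut QQ) (simp add: supported_def)
    fix v assume v: "v \<in> U"
    have "inner (Q F) v = 0" using v by (simp add: U_def is_proj_selfadjoint[OF Q(2)])
    moreover have "inner (cut {i} F) v = inner F v"
      using v by (simp add: U_def inner_cut cut_supported)
    ultimately show "inner (F - (cut {i} F - Q F)) v = 0" by (simp add: inner_diff_left)
  qed
  then have "vdim U = tr (\<lambda>F. cut {i} F - Q F)" by (rule vdim_eq_tr[OF _ kernels_subspace[OF U]])
  also have "\<dots> = tr (cut {i}) - tr Q" by (simp add: tr_def inner_diff_left sum_subtractf)
  also have "tr (cut {i}) = 1"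
    using vdim_eq_tr[OF is_proj_cut kernels_subspace[OF supported_kernels[OF iI]]]
      vdim_supported[OF iI] by simp
  also have "tr Q = nullity (entry P i i)"
    using vdim_eq_tr[OF Q(2) kernels_subspace[OF N]] vdim_nullspace[OF c i] by simp
  finally have dU: "vdim U = 1 - nullity (entry P i i)" .
  have "cut {i} v \<in> U" if v: "v \<in> V" for v
  proof -
    have "inner (Q v) z = 0" for z
    proof -
      let ?w = "Q z"
      have w: "?w \<in> supported {i}" and e: "entry P i i (coord (down i ?w)) = (\<lambda>x. 0)"
        using QN[of z] by (auto simp: nullspace_def)
      have ud: "up i (Abs_l2 (coord (down i ?w))) = ?w"
        by (rule l2_eqI) (use w in \<open>auto simp: coord_inverse coord_up coord_down supported_def split: prod.splits\<close>)
      have "down i (P ?w) = 0"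
        using e unfolding entry_apply[OF down_in_ell2] ud by (intro l2_eqI) simp
      have "(norm (P ?w))\<^sup>2 = inner (P ?w) ?w" by (rule is_proj_inner_self[OF P(2), symmetric])
      also have "\<dots> = inner (down i (P ?w)) (down i ?w)"
        using inner_up[of i "down i ?w" "P ?w"] ud by (simp add: coord_inverse inner_commute)
      also have "\<dots> = 0" using \<open>down i (P ?w) = 0\<close> by simp
      finally have Pw: "P ?w = 0" by simp
      have "inner (Q v) z = inner v ?w" by (rule is_proj_selfadjoint[OF Q(2)])
      also have "\<dots> = inner (P v) ?w"
        by (simp only: is_proj_apply_mem[OF P(2) kernels_subspace[OF V] v])
      also have "\<dots> = 0" by (simp only: is_proj_selfadjoint[OF P(2)] Pw inner_zero_right)
      finally show ?thesis .
    qed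
    then have "Q v = 0" using inner_eq_zero_iff by blast
    then show ?thesis by (simp add: U_def cut_in_supported Qcut)
  qed
  from vdim_le_kernel_plus_range[OF V U cut_M[OF iI] this] show ?thesis by (simp only: dU)
qed

end

section \<open>Twisted Laurent polynomials\<close>

lemma pure_part_laurent_init:
  assumes "x \<noteq> (\<lambda>i. \<zero>\<^bsub>R\<^esub>)" and "finite {i. x i \<noteq> \<zero>\<^bsub>R\<^esub>}"
  shows "x (Min {i. x i \<noteq> \<zero>\<^bsub>R\<^esub>}) \<noteq> \<zero>\<^bsub>R\<^esub>"
    and "pure_part R (laurent_init R x) = x (Min {i. x i \<noteq> \<zero>\<^bsub>R\<^esub>})"
proof -
  let ?k = "Min {i. x i \<noteq> \<zero>\<^bsub>R\<^esub>}"
  have "?k \<in> {i. x i \<noteq> \<zero>\<^bsub>R\<^esub>}" by (rule Min_in) (use assms in auto)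
  then show k: "x ?k \<noteq> \<zero>\<^bsub>R\<^esub>" by simp
  let ?m = "\<lambda>i. if i = ?k then x i else \<zero>\<^bsub>R\<^esub>"
  have "?m \<noteq> (\<lambda>i. \<zero>\<^bsub>R\<^esub>)" using k by (metis (full_types))
  moreover have "(THE j. ?m j \<noteq> \<zero>\<^bsub>R\<^esub>) = ?k" using k by (intro the_equality) (auto split: if_splits)
  ultimately show "pure_part R (laurent_init R x) = x ?k"
    using assms(1) by (simp add: laurent_init_def pure_part_def)
qed

context group
begin

lemma group_vN_abelian_monoid: "abelian_monoid (group_vN G)"
proof (rule abelian_monoidI)
  show "x \<oplus>\<^bsub>group_vN G\<^esub> y \<in> carrier (group_vN G)"
    if "x \<in> carrier (group_vN G)" "y \<in> carrier (group_vN G)" for x y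
    using group_vN_add[OF that] by (simp add: group_vN_def)
  show "\<zero>\<^bsub>group_vN G\<^esub> \<in> carrier (group_vN G)"
    using group_vN_zero by (simp add: group_vN_def)
qed (auto simp: group_vN_def fun_eq_iff)

lemma group_vN_finsum:
  assumes "finite A" "\<And>i. i \<in> A \<Longrightarrow> F i \<in> carrier (group_vN G)"
  shows "finsum (group_vN G) F A = (\<lambda>f x. \<Sum>i\<in>A. F i f x)"
  using assms
proof (induction A rule: finite_induct)
  case empty
  then show ?case
    by (simp add: abelian_monoid.finsum_empty[OF group_vN_abelian_monoid]) (simp add: group_vN_def)
next
  case (insert i A)
  then have "finsum (group_vN G) F (insert i A) = F i \<oplus>\<^bsub>group_vN G\<^esub> finsum (group_vN G) F A"
    by (intro abelian_monoid.finsum_insert[OF group_vN_abelian_monoid]) auto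
  also have "\<dots> = (\<lambda>f x. \<Sum>i\<in>insert i A. F i f x)"
    using insert by (simp add: group_vN_def)
  finally show ?case .
qed

lemma nullity_bounds:
  assumes a: "a \<in> carrier (group_vN G)"
  shows "vN_dim G (ell2_kernel (carrier G) a) \<le> 1"
    and "vN_dim G (ell2_kernel (carrier G) (\<lambda>f x. 0)) = 1"
proof -
  interpret l2_copies G "{()}" by standard simp
  show "nullity a \<le> 1" by (rule nullity_le_1[OF a]) simp
  show "nullity (\<lambda>f x. 0) = 1" by (rule nullity_zero) simp
qed

lemma exists_kernel_delta_proj:
  assumes a: "a \<in> carrier (group_vN G)"
  shows "\<exists>p \<in> ell2_kernel (carrier G) a. vN_dim G (ell2_kernel (carrier G) a) = Re (p \<one>) \<and>
    (\<forall>v \<in> ell2_kernel (carrier G) a. inner (delta \<one> - Abs_l2 p) (Abs_l2 v) = 0)"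
proof -
  interpret l2_copies G "{()}" by standard simp
  show ?thesis using kernel_delta_proj[OF a, of "()"] vdim_nullspace[OF a, of "()"] by simp
qed

text \<open>
  The zero polynomial and a vanishing coefficient both have nullity \<open>1\<close>, the largest possible value.
  This lets both parts hold without a case distinction for zero.
\<close>

lemma nullity_initial:
  assumes "x \<in> carrier (twisted_laurent (group_vN G) \<alpha>)"
  defines "nul \<equiv> \<lambda>a. vN_dim G (ell2_kernel (carrier G) a)"
  shows "\<exists>k. (\<forall>j<k. x j = (\<lambda>f x. 0)) \<and>
      nul (pure_part (group_vN G) (laurent_init (group_vN G) x)) = nul (x k)"
    and "(\<forall>j<c. x j = (\<lambda>f x. 0)) \<Longrightarrow>
      nul (pure_part (group_vN G) (laurent_init (group_vN G) x)) \<le> nul (x c)"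
proof -
  let ?R = "group_vN G"
  have z: "\<zero>\<^bsub>?R\<^esub> = (\<lambda>f x. 0)" by (simp add: group_vN_def)
  have x: "x i \<in> carrier ?R" for i using assms(1) by (simp add: twisted_laurent_def)
  have fin: "finite {i. x i \<noteq> \<zero>\<^bsub>?R\<^esub>}" using assms(1) by (simp add: twisted_laurent_def)
  show 1: "\<exists>k. (\<forall>j<k. x j = (\<lambda>f x. 0)) \<and> nul (pure_part ?R (laurent_init ?R x)) = nul (x k)"
  proof (cases "x = (\<lambda>i. \<zero>\<^bsub>?R\<^esub>)")
    case True
    then show ?thesis by (simp add: laurent_init_def pure_part_def z)
  next
    case False
    have "x j = (\<lambda>f x. 0)" if "j < Min {i. x i \<noteq> \<zero>\<^bsub>?R\<^esub>}" for j
      using Min_le[OF fin, of j] that by (force simp: z)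
    then show ?thesis using pure_part_laurent_init(2)[OF False fin] by metis
  qed
  assume c: "\<forall>j<c. x j = (\<lambda>f x. 0)"
  show "nul (pure_part ?R (laurent_init ?R x)) \<le> nul (x c)"
  proof (cases "x c = (\<lambda>f x. 0)")
    case True
    then have "nul (x c) = 1" using nullity_bounds(2)[OF x] by (simp add: nul_def)
    then show ?thesis using 1 nullity_bounds(1)[OF x] by (auto simp: nul_def)
  next
    case False
    then have ne: "x \<noteq> (\<lambda>i. \<zero>\<^bsub>?R\<^esub>)" by (auto simp: z)
    have "Min {i. x i \<noteq> \<zero>\<^bsub>?R\<^esub>} = c"
      by (rule Min_eqI[OF fin]) (use c False in \<open>auto simp: z not_less[symmetric]\<close>)
    then show ?thesis using pure_part_laurent_init(2)[OF ne fin] by simp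
  qed
qed

end

context normal
begin

abbreviation K where "K \<equiv> G\<lparr>carrier := H\<rparr>"

lemma K_group: "group K"
  by (rule subgroup_is_group) (rule is_group)

text \<open>
  Conjugation by left translation, on vectors: \<open>vN_conj G H g a\<close> is \<open>a\<close> conjugated by \<open>twist g\<close>.
\<close>

definition twist :: "'a \<Rightarrow> ('a \<Rightarrow> complex) \<Rightarrow> 'a \<Rightarrow> complex" where
  "twist g f = (\<lambda>k. if k \<in> H then f (g \<otimes> k \<otimes> inv g) else 0)"

lemma twist_pull:
  assumes g: "g \<in> carrier G" and f: "f \<in> ell2 H"
  shows "inj_on (\<lambda>k. g \<otimes> k \<otimes> inv g) H"
    and "coord (pull H (\<lambda>k. g \<otimes> k \<otimes> inv g) (Abs_l2 f)) = twist g f"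
    and "twist g f \<in> ell2 H"
    and "Abs_l2 (twist g f) = pull H (\<lambda>k. g \<otimes> k \<otimes> inv g) (Abs_l2 f)"
proof -
  show inj: "inj_on (\<lambda>k. g \<otimes> k \<otimes> inv g) H"
    using g by (auto simp: inj_on_def)
  show c: "coord (pull H (\<lambda>k. g \<otimes> k \<otimes> inv g) (Abs_l2 f)) = twist g f"
    by (simp add: coord_pull[OF inj] coord_Abs_l2[OF f] twist_def fun_eq_iff)
  show "twist g f \<in> ell2 H"
    unfolding c[symmetric] by (rule coord_in_ell2) (simp add: coord_pull[OF inj])
  show "Abs_l2 (twist g f) = pull H (\<lambda>k. g \<otimes> k \<otimes> inv g) (Abs_l2 f)"
    unfolding c[symmetric] by (rule coord_inverse)
qed

lemma inv_mult_cancel [simp]: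
  assumes "x \<in> carrier G" "y \<in> carrier G"
  shows "inv x \<otimes> (x \<otimes> y) = y" and "x \<otimes> (inv x \<otimes> y) = y"
  using assms by (simp_all flip: m_assoc)

lemma conj_cancel:
  assumes "g \<in> carrier G" "k \<in> carrier G"
  shows "inv g \<otimes> (g \<otimes> k \<otimes> inv g) \<otimes> g = k" and "g \<otimes> (inv g \<otimes> k \<otimes> g) \<otimes> inv g = k"
  using assms by (simp_all add: m_assoc)

lemma twist_twist:
  assumes g: "g \<in> carrier G" and f: "f \<in> ell2 H"
  shows "twist g (twist (inv g) f) = f"
  using g by (auto simp: twist_def fun_eq_iff conj_cancel inv_op_closed1 inv_op_closed2
      ell2_outside[OF f])

lemma twist_right_trans:
  assumes g: "g \<in> carrier G" and h: "h \<in> H"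
  shows "twist g (right_trans K h f) = right_trans K (inv g \<otimes> h \<otimes> g) (twist g f)"
proof
  fix k
  define h' where "h' = inv g \<otimes> h \<otimes> g"
  have h': "h' \<in> H" using g h by (simp add: h'_def inv_op_closed1)
  have iK: "inv\<^bsub>K\<^esub> y = inv y" if "y \<in> H" for y
    using that by (rule m_inv_consistent[OF subgroup_axioms])
  show "twist g (right_trans K h f) k = right_trans K (inv g \<otimes> h \<otimes> g) (twist g f) k"
  proof (cases "k \<in> H")
    case k: True
    have "k \<otimes> inv h' \<in> H" using k h' by simp
    moreover have "g \<otimes> k \<otimes> inv g \<in> H" using g k by (simp add: inv_op_closed2)
    moreover have "g \<otimes> (k \<otimes> inv h') \<otimes> inv g = g \<otimes> k \<otimes> inv g \<otimes> inv h"
      using g h k by (simp add: h'_def inv_mult_group m_assoc)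
    ultimately show ?thesis
      unfolding h'_def[symmetric] using k h h' by (simp add: twist_def right_trans_def iK)
  qed (simp add: twist_def right_trans_def)
qed

lemma inner_twist:
  assumes g: "g \<in> carrier G" and f: "f \<in> ell2 H" and f': "f' \<in> ell2 H"
  shows "inner (Abs_l2 (twist g f)) (Abs_l2 f') = inner (Abs_l2 f) (Abs_l2 (twist (inv g) f'))"
  unfolding twist_pull(4)[OF g f] twist_pull(4)[OF inv_closed[OF g] f']
  by (rule inner_pull[OF twist_pull(1)[OF g f]])
    (use g in \<open>auto simp: conj_cancel inv_op_closed1 inv_op_closed2\<close>)

text \<open>
  The definition of \<open>vN_conj\<close> evaluates the induced operator at \<open>inv g \<otimes> x\<close>, which reads off the
  value of \<open>a\<close> at the unit. Equivariance of \<open>a\<close> under right translation by \<open>inv g \<otimes> x \<otimes> g \<in> H\<close>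
  moves this to a value of \<open>a (twist g f)\<close>.
\<close>

lemma vN_conj_apply:
  assumes a: "a \<in> carrier (group_vN K)" and g: "g \<in> carrier G" and f: "f \<in> ell2 H"
  shows "vN_conj G H g a f = twist (inv g) (a (twist g f))"
proof
  fix x
  interpret K: group K by (rule K_group)
  note A = K.group_vN_carrierD[OF a, simplified]
  define f' where "f' = left_trans G (inv g) f"
  have f'_apply: "f' z = (if z \<in> carrier G then f (g \<otimes> z) else 0)" for z
    using g by (simp add: f'_def left_trans_def)
  have "inj_on (\<lambda>z. g \<otimes> z) (carrier G)" using g by (auto simp: inj_on_def)
  then have "coord (pull (carrier G) (\<lambda>z. g \<otimes> z) (Abs_l2 f)) = f'"
    by (simp add: coord_pull coord_Abs_l2[OF f] f'_apply fun_eq_iff)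
  moreover have "f' z = 0" if "z \<notin> carrier G" for z using that by (simp add: f'_apply)
  ultimately have f': "f' \<in> ell2 (carrier G)" by (metis coord_in_ell2)
  note a0 = K.group_vN_at_zero[OF a]
  have "vN_conj G H g a f x = left_trans G g (vN_induce G H a f') x"
    using f by (simp add: vN_conj_def ell2_restrict_def f'_def)
  also have "\<dots> = (if x \<in> carrier G
      then a (\<lambda>k. if k \<in> H then f' (k \<otimes> (inv g \<otimes> x)) else 0) \<one> else 0)"
    using f' g by (simp add: left_trans_def vN_induce_def ell2_restrict_def)
  also have "\<dots> = twist (inv g) (a (twist g f)) x"
  proof (cases "x \<in> H")
    case True
    define h where "h = inv g \<otimes> x \<otimes> g"
    have h: "h \<in> H" using True g by (simp add: h_def inv_op_closed1)
    have ih: "inv\<^bsub>K\<^esub> (inv h) = h"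
      using h by (simp add: m_inv_consistent[OF subgroup_axioms])
    have "(\<lambda>k. if k \<in> H then f' (k \<otimes> (inv g \<otimes> x)) else 0) = right_trans K (inv h) (twist g f)"
    proof
      fix k
      show "(if k \<in> H then f' (k \<otimes> (inv g \<otimes> x)) else 0) = right_trans K (inv h) (twist g f) k"
      proof (cases "k \<in> H")
        case k: True
        have "g \<otimes> (k \<otimes> h) \<otimes> inv g = g \<otimes> (k \<otimes> (inv g \<otimes> x))"
          using g k True by (simp add: h_def m_assoc)
        then show ?thesis using g h k True by (simp add: right_trans_def ih f'_apply twist_def)
      qed (simp add: right_trans_def)
    qed
    then have "a (\<lambda>k. if k \<in> H then f' (k \<otimes> (inv g \<otimes> x)) else 0) \<one> =
        right_trans K (inv h) (a (twist g f)) \<one>"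
      using A(5)[of "inv h" "twist g f"] h twist_pull(3)[OF g f] by simp
    also have "\<dots> = a (twist g f) h" using h by (simp add: right_trans_def ih)
    finally show ?thesis using True g by (simp add: twist_def h_def)
  next
    case False
    have "(if k \<in> H then f' (k \<otimes> (inv g \<otimes> x)) else 0) = 0" if x: "x \<in> carrier G" for k
    proof (cases "k \<in> H")
      case k: True
      have "g \<otimes> (k \<otimes> (inv g \<otimes> x)) = (g \<otimes> k \<otimes> inv g) \<otimes> x"
        using g k x by (simp add: m_assoc)
      moreover have "(g \<otimes> k \<otimes> inv g) \<otimes> x \<notin> H"
      proof
        assume "(g \<otimes> k \<otimes> inv g) \<otimes> x \<in> H"
        moreover have "inv (g \<otimes> k \<otimes> inv g) \<in> H" using g k by (simp add: inv_op_closed2)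
        ultimately have "inv (g \<otimes> k \<otimes> inv g) \<otimes> ((g \<otimes> k \<otimes> inv g) \<otimes> x) \<in> H"
          by (rule subgroup.m_closed[OF subgroup_axioms, rotated])
        then have "x \<in> H" using g k x by simp
        then show False using False by simp
      qed
      ultimately show ?thesis using g k x ell2_outside[OF f] by (simp add: f'_apply)
    qed simp
    then show ?thesis using False a0 by (simp add: twist_def)
  qed
  finally show "vN_conj G H g a f x = twist (inv g) (a (twist g f)) x" .
qed

lemma vN_conj_zero: "g \<in> carrier G \<Longrightarrow> vN_conj G H g (\<lambda>f x. 0) = (\<lambda>f x. 0)"
proof (intro ext)
  fix f x assume g: "g \<in> carrier G"
  interpret K: group K by (rule K_group)
  show "vN_conj G H g (\<lambda>f x. 0) f x = 0"
  proof (cases "f \<in> ell2 H")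
    case True
    then show ?thesis using vN_conj_apply[OF K.group_vN_zero g True] by (simp add: twist_def)
  qed (simp add: vN_conj_def ell2_restrict_def)
qed

lemma vN_conj_carrier:
  assumes a: "a \<in> carrier (group_vN K)" and g: "g \<in> carrier G"
  shows "vN_conj G H g a \<in> carrier (group_vN K)"
proof -
  interpret K: group K by (rule K_group)
  note A = K.group_vN_carrierD[OF a, simplified]
  note ig = inv_closed[OF g]
  obtain C where C: "C \<ge> 0" "\<And>f. f \<in> ell2 H \<Longrightarrow> norm (Abs_l2 (a f)) \<le> C * norm (Abs_l2 f)"
    using A(3) by blast
  have mem: "a (twist g f) \<in> ell2 H" if "f \<in> ell2 H" for f
    by (rule A(1)[OF twist_pull(3)[OF g that]])
  show ?thesis
  proof (rule K.group_vN_carrierI[where K = C])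
    fix f assume "f \<in> ell2 (carrier K)"
    then have f: "f \<in> ell2 H" by simp
    show "vN_conj G H g a f \<in> ell2 (carrier K)"
      using twist_pull(3)[OF ig mem[OF f]] by (simp add: vN_conj_apply[OF a g f])
    have "norm (Abs_l2 (vN_conj G H g a f)) \<le> norm (Abs_l2 (a (twist g f)))"
      unfolding vN_conj_apply[OF a g f] twist_pull(4)[OF ig mem[OF f]]
      by (rule norm_pull_le[OF twist_pull(1)[OF ig mem[OF f]]])
    also have "\<dots> \<le> C * norm (Abs_l2 (twist g f))" by (rule C(2)[OF twist_pull(3)[OF g f]])
    also have "\<dots> \<le> C * norm (Abs_l2 f)"
      unfolding twist_pull(4)[OF g f]
      by (rule mult_left_mono[OF norm_pull_le[OF twist_pull(1)[OF g f]] C(1)])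
    finally show "norm (Abs_l2 (vN_conj G H g a f)) \<le> C * norm (Abs_l2 f)" .
    fix h assume "h \<in> carrier K"
    then have h: "h \<in> H" by simp
    define h' where "h' = inv g \<otimes> h \<otimes> g"
    have h': "h' \<in> H" using g h by (simp add: h'_def inv_op_closed1)
    have tw: "twist g (right_trans K h f) = right_trans K h' (twist g f)"
      unfolding h'_def by (rule twist_right_trans[OF g h])
    have "inv (inv g) \<otimes> h' \<otimes> inv g = h" using g h by (simp add: h'_def conj_cancel)
    then have tw': "twist (inv g) (right_trans K h' f) = right_trans K h (twist (inv g) f)" for f
      using twist_right_trans[OF ig h'] by simp
    have rf: "right_trans K h f \<in> ell2 H" using K.right_trans_in_ell2[of h f] h f by simp
    have "a (right_trans K h' (twist g f)) = right_trans K h' (a (twist g f))"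
      by (rule A(5)[OF h' twist_pull(3)[OF g f]])
    then show "vN_conj G H g a (right_trans K h f) = right_trans K h (vN_conj G H g a f)"
      by (simp only: vN_conj_apply[OF a g f] vN_conj_apply[OF a g rf] tw tw')
  next
    fix f f' c d assume "f \<in> ell2 (carrier K)" "f' \<in> ell2 (carrier K)"
    then have f: "f \<in> ell2 H" and f': "f' \<in> ell2 H" by simp_all
    have "twist g (\<lambda>x. c * f x + d * f' x) = (\<lambda>x. c * twist g f x + d * twist g f' x)"
      by (auto simp: twist_def)
    then have "a (twist g (\<lambda>x. c * f x + d * f' x)) =
        (\<lambda>x. c * a (twist g f) x + d * a (twist g f') x)"
      using A(2)[OF twist_pull(3)[OF g f] twist_pull(3)[OF g f']] by simp
    then show "vN_conj G H g a (\<lambda>x. c * f x + d * f' x) =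
        (\<lambda>x. c * vN_conj G H g a f x + d * vN_conj G H g a f' x)"
      by (auto simp: vN_conj_apply[OF a g] f f' ell2_lincomb twist_def)
  next
    fix f assume "f \<notin> ell2 (carrier K)"
    then show "vN_conj G H g a f = (\<lambda>x. 0)" by (simp add: vN_conj_def ell2_restrict_def)
  qed
qed

text \<open>
  Conjugation carries kernels to kernels isometrically and fixes the basis vector at the unit, with
  which the dimension is computed.
\<close>

lemma vN_conj_nullity:
  assumes a: "a \<in> carrier (group_vN K)" and g: "g \<in> carrier G"
  shows "vN_dim K (ell2_kernel H (vN_conj G H g a)) = vN_dim K (ell2_kernel H a)"
proof -
  interpret K: group K by (rule K_group)
  note ig = inv_closed[OF g]
  have tw0: "twist g' (\<lambda>x. 0) = (\<lambda>x. 0)" for g' by (auto simp: twist_def)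
  obtain p where p: "p \<in> ell2_kernel H a" "vN_dim K (ell2_kernel H a) = Re (p \<one>)"
    and orth: "\<And>v. v \<in> ell2_kernel H a \<Longrightarrow> inner (delta \<one> - Abs_l2 p) (Abs_l2 v) = 0"
    using K.exists_kernel_delta_proj[OF a] by auto
  have p_mem: "p \<in> ell2 H" and ap: "a p = (\<lambda>x. 0)" using p(1) by (auto simp: ell2_kernel_def)
  let ?p = "twist (inv g) p"
  have p': "?p \<in> ell2 H" by (rule twist_pull(3)[OF ig p_mem])
  have "vN_dim K (ell2_kernel (carrier K) (vN_conj G H g a)) = Re (?p \<one>\<^bsub>K\<^esub>)"
  proof (rule K.vN_dim_kernel_eqI[OF vN_conj_carrier[OF a g]])
    show "?p \<in> ell2_kernel (carrier K) (vN_conj G H g a)"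
      using p' by (simp add: ell2_kernel_def vN_conj_apply[OF a g p'] twist_twist[OF g p_mem] ap tw0)
    fix v assume "v \<in> ell2_kernel (carrier K) (vN_conj G H g a)"
    then have v: "v \<in> ell2 H" and "vN_conj G H g a v = (\<lambda>x. 0)" by (auto simp: ell2_kernel_def)
    then have "twist g (twist (inv g) (a (twist g v))) = twist g (\<lambda>x. 0)"
      using vN_conj_apply[OF a g v] by simp
    moreover have "a (twist g v) \<in> ell2 H"
      using K.group_vN_carrierD(1)[OF a, of "twist g v"] twist_pull(3)[OF g v] by simp
    ultimately have av: "a (twist g v) = (\<lambda>x. 0)" using twist_twist[OF g] by (simp add: tw0)
    have tv: "twist g v \<in> ell2_kernel H a" using av twist_pull(3)[OF g v] by (simp add: ell2_kernel_def)
    have d: "ell2_delta \<one> \<in> ell2 H" by (rule ell2_delta_in_ell2) simp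
    have twd: "twist (inv g) (ell2_delta \<one>) = ell2_delta \<one>"
      using g by (auto simp: twist_def ell2_delta_def fun_eq_iff inv_solve_left' inv_solve_right' m_assoc)
    have "inner (delta \<one>) (Abs_l2 v) = inner (delta \<one>) (Abs_l2 (twist g v))"
      using inner_twist[OF ig d v] g by (simp add: twd Abs_l2_delta)
    moreover have "inner (Abs_l2 ?p) (Abs_l2 v) = inner (Abs_l2 p) (Abs_l2 (twist g v))"
      using inner_twist[OF ig p_mem v] g by simp
    ultimately have "inner (delta \<one> - Abs_l2 ?p) (Abs_l2 v) = inner (delta \<one> - Abs_l2 p) (Abs_l2 (twist g v))"
      by (simp add: inner_diff_left)
    then show "inner (delta \<one>\<^bsub>K\<^esub> - Abs_l2 ?p) (Abs_l2 v) = 0" using orth[OF tv] by simp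
  qed
  then show ?thesis using g p(2) by (simp add: twist_def)
qed

end

section \<open>Common right multiples\<close>

text \<open>
  The equation \<open>q r = q' r'\<close> is a lower triangular system with band width \<open>d\<close> in the coefficients of
  \<open>r\<close> and \<open>r'\<close>; the diagonal entries are conjugates of the initial coefficients of \<open>q\<close> and \<open>q'\<close>.

  Unknowns and equations are indexed by \<open>bool \<times> int\<close>: \<open>(False, s)\<close> stands for \<open>x\<^sub>s\<close> and
  \<open>(True, s)\<close> for \<open>y\<^sub>s\<close>, and the \<open>m\<close>-th equation is \<open>(False, m)\<close>. The space \<open>W i\<close> consists of the
  solutions supported in \<open>i..n\<close>. Passing from \<open>W i\<close> to \<open>W (i + 1)\<close> first puts \<open>x\<^sub>i = 0\<close>, at the price
  of at most one minus the nullity of a diagonal entry of the projection onto \<open>W i\<close>. Then the \<open>i\<close>-th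
  equation reads \<open>c'\<^sub>i\<^sub>i y\<^sub>i = 0\<close>, so putting \<open>y\<^sub>i = 0\<close> costs at most \<open>\<nu>\<close>. If the former price were at most
  \<open>1 - \<nu> - \<epsilon>\<close> for every \<open>i\<close>, then \<open>W 0\<close> would have dimension at most \<open>(n + 1) (1 - \<epsilon>)\<close>, but counting
  unknowns and equations gives at least \<open>n + 1 - d\<close>.
\<close>

lemma (in group) triangular_system_solution:
  fixes c c' :: "int \<Rightarrow> int \<Rightarrow> 'a vec_op" and d :: nat and \<epsilon> \<nu> :: real
  assumes c: "\<And>m s. c m s \<in> carrier (group_vN G)" and c': "\<And>m s. c' m s \<in> carrier (group_vN G)"
    and upper: "\<And>m s. m < s \<Longrightarrow> c m s = (\<lambda>f x. 0) \<and> c' m s = (\<lambda>f x. 0)"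
    and lower: "\<And>m s. s + int d < m \<Longrightarrow> c m s = (\<lambda>f x. 0) \<and> c' m s = (\<lambda>f x. 0)"
    and \<nu>: "\<And>s. vN_dim G (ell2_kernel (carrier G) (c' s s)) = \<nu>"
    and "\<epsilon> > 0"
  shows "\<exists>i n x y. i \<le> n \<and> (\<forall>s. x s \<in> carrier (group_vN G) \<and> y s \<in> carrier (group_vN G)) \<and>
    (\<forall>s. s \<notin> {i..n} \<longrightarrow> x s = (\<lambda>f x. 0) \<and> y s = (\<lambda>f x. 0)) \<and>
    vN_dim G (ell2_kernel (carrier G) (x i)) < \<nu> + \<epsilon> \<and>
    (\<forall>m f z. (\<Sum>s\<in>{i..n}. c m s (x s f) z) = (\<Sum>s\<in>{i..n}. c' m s (y s f) z))"
proof -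
  \<comment> \<open>So many unknowns that the band width costs each degree less than \<open>\<epsilon>\<close> on average.\<close>
  obtain n :: nat where n: "real d < (real n + 1) * \<epsilon>"
  proof -
    obtain n :: nat where "real d / \<epsilon> < real n" using reals_Archimedean2 by blast
    then have "real d < real n * \<epsilon>" using \<open>\<epsilon> > 0\<close> by (simp add: field_simps)
    then show thesis using \<open>\<epsilon> > 0\<close> that[of n] by (simp add: distrib_right)
  qed
  define D where "D = int n + int d"
  define I :: "(bool \<times> int) set" where "I = UNIV \<times> {0..D}"
  interpret l2_copies G I by standard (simp add: I_def)
  have idx: "(b, s) \<in> I" if "0 \<le> s" "s \<le> int n" for b s using that by (auto simp: I_def D_def)
  define T where "T F = (\<Sum>m\<in>{0..D}. \<Sum>s\<in>{0..int n}.
      block (c m s) (False, m) (False, s) F - block (c' m s) (False, m) (True, s) F)" for F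
  have T: "T \<in> M"
    unfolding T_def by (intro M_sum M_diff block_M c c') (auto simp: I_def D_def)
  note blT = commutant_bounded_linear[OF T]
  have coord_T: "coord (T F) (z, b, m) = (if z \<in> carrier G \<and> b = False \<and> m \<in> {0..D} then
      (\<Sum>s\<in>{0..int n}. c m s (coord (down (False, s) F)) z - c' m s (coord (down (True, s) F)) z)
      else 0)" for F z b m
  proof -
    have "coord (T F) (z, b, m) = (\<Sum>m'\<in>{0..D}. if m' = m then (if z \<in> carrier G \<and> b = False then
      (\<Sum>s\<in>{0..int n}. c m s (coord (down (False, s) F)) z - c' m s (coord (down (True, s) F)) z)
      else 0) else 0)"
      unfolding T_def coord_sum by (intro sum.cong refl) (auto simp: coord_block[OF c] coord_block[OF c'])
    then show ?thesis by simp
  qed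
  define W where "W i = supported (UNIV \<times> {i..int n}) \<inter> {F. T F = 0}" for i
  have sub: "UNIV \<times> {i..int n} \<subseteq> I" if "0 \<le> i" for i using that by (auto simp: I_def D_def)
  have W: "W i \<in> kernels" if "0 \<le> i" for i
    unfolding W_def by (rule kernels_Int[OF supported_kernels[OF sub[OF that]] kernelsI[OF T refl]])
  have row: "(\<Sum>s\<in>{0..int n}. c m s (coord (down (False, s) F)) z) =
      (\<Sum>s\<in>{0..int n}. c' m s (coord (down (True, s) F)) z)" if F: "F \<in> W i" for F m i z
  proof (cases "z \<in> carrier G \<and> m \<in> {0..D}")
    case True
    then have "coord (T F) (z, False, m) = (\<Sum>s\<in>{0..int n}.
        c m s (coord (down (False, s) F)) z - c' m s (coord (down (True, s) F)) z)"
      by (simp add: coord_T)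
    then show ?thesis using F by (simp add: W_def sum_subtractf)
  next
    case False
    have "c m s (coord (down (False, s) F)) z = 0 \<and> c' m s (coord (down (True, s) F)) z = 0"
      if "s \<in> {0..int n}" for s
    proof (cases "z \<in> carrier G")
      case True
      then have "m \<notin> {0..D}" using False by blast
      then have "m < s \<or> s + int d < m" using that unfolding D_def atLeastAtMost_iff by linarith
      then show ?thesis using upper[of m s] lower[of s m] by auto
    next
      case False
      then show ?thesis
        using ell2_outside[OF group_vN_carrierD(1)[OF c[of m s] down_in_ell2[of "(False, s)" F]] False]
          ell2_outside[OF group_vN_carrierD(1)[OF c'[of m s] down_in_ell2[of "(True, s)" F]] False] by simp
    qed
    then have "\<forall>s\<in>{0..int n}. c m s (coord (down (False, s) F)) z = 0"
      "\<forall>s\<in>{0..int n}. c' m s (coord (down (True, s) F)) z = 0" by blast+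
    then show ?thesis by (simp only: sum.neutral)
  qed
  \<comment> \<open>In the \<open>i\<close>-th equation, unknowns below \<open>i\<close> vanish and coefficients above \<open>i\<close> do.\<close>
  have leading: "c i i (coord (down (False, i) F)) = c' i i (coord (down (True, i) F))"
    if F: "F \<in> W i" and i: "0 \<le> i" "i \<le> int n" for F i
  proof
    fix z
    have *: "coord (down (b, s) F) = (\<lambda>x. 0)" if "s < i" for b s
      by (rule down_supported[of F "UNIV \<times> {i..int n}"]) (use F that in \<open>auto simp: W_def\<close>)
    have "(\<Sum>s\<in>{0..int n}. c i s (coord (down (False, s) F)) z) =
        (\<Sum>s\<in>{0..int n}. if s = i then c i i (coord (down (False, i) F)) z else 0)"
    proof (intro sum.cong refl)
      fix s
      show "c i s (coord (down (False, s) F)) z = (if s = i then c i i (coord (down (False, i) F)) z else 0)"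
        by (cases s i rule: linorder_cases) (simp_all add: * upper group_vN_at_zero[OF c])
    qed
    moreover have "(\<Sum>s\<in>{0..int n}. c' i s (coord (down (True, s) F)) z) =
        (\<Sum>s\<in>{0..int n}. if s = i then c' i i (coord (down (True, i) F)) z else 0)"
    proof (intro sum.cong refl)
      fix s
      show "c' i s (coord (down (True, s) F)) z = (if s = i then c' i i (coord (down (True, i) F)) z else 0)"
        by (cases s i rule: linorder_cases) (simp_all add: * upper group_vN_at_zero[OF c'])
    qed
    ultimately show "c i i (coord (down (False, i) F)) z = c' i i (coord (down (True, i) F)) z"
      using row[OF F, of i z] i by simp
  qed
  have step: "vdim (W i) \<le> vdim (W (i + 1)) + \<nu> + (1 - nullity (entry P (False, i) (False, i)))"
    if i: "0 \<le> i" "i \<le> int n" and P: "P \<in> M" "is_proj P (W i)" for i P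
  proof -
    let ?V = "{F \<in> W i. cut {(False, i)} F = 0}"
    have cutM: "cut {(b, i)} \<in> M" for b by (rule cut_M) (use idx i in auto)
    have V: "?V \<in> kernels"
      using kernels_Int[OF W[OF i(1)] kernelsI[OF cutM refl]] by (simp add: Int_def)
    have down_cut: "coord (down l (cut {l} F)) = coord (down l F)" for l F
      by (auto simp: coord_down coord_cut)
    have cut0: "coord F (x, b, i) = 0" if "cut {(b, i)} F = 0" "x \<in> carrier G" for b F x
      using coord_cut[of "{(b, i)}" F x "(b, i)"] that by simp
    have "vdim ?V \<le> vdim {F \<in> ?V. cut {(True, i)} F = 0} + vdim (nullspace (True, i) (c' i i))"
    proof (rule vdim_le_kernel_plus_range[OF V _ cutM])
      show "nullspace (True, i) (c' i i) \<in> kernels" by (rule nullspace_kernels[OF c' idx[OF i]])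
      fix F assume F: "F \<in> ?V"
      then have "coord (down (False, i) F) = (\<lambda>x. 0)"
        using cut0[of False F] by (simp add: coord_down fun_eq_iff)
      then have "c' i i (coord (down (True, i) F)) = (\<lambda>x. 0)"
        using leading[of F i] F i by (simp add: group_vN_at_zero[OF c])
      then show "cut {(True, i)} F \<in> nullspace (True, i) (c' i i)"
        by (simp add: nullspace_def cut_in_supported down_cut)
    qed
    moreover have "vdim (nullspace (True, i) (c' i i)) = \<nu>"
      using vdim_nullspace[OF c' idx[OF i]] \<nu> by simp
    moreover have "vdim {F \<in> ?V. cut {(True, i)} F = 0} \<le> vdim (W (i + 1))"
    proof (rule vdim_mono)
      show "{F \<in> ?V. cut {(True, i)} F = 0} \<in> kernels"
        using kernels_Int[OF V kernelsI[OF cutM refl]] by (simp add: Int_def)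
      show "W (i + 1) \<in> kernels" using W i by simp
      show "{F \<in> ?V. cut {(True, i)} F = 0} \<subseteq> W (i + 1)"
      proof
        fix F assume F: "F \<in> {F \<in> ?V. cut {(True, i)} F = 0}"
        have z: "coord F (x, b, i) = 0" if "x \<in> carrier G" for x b
          by (rule cut0[OF _ that]) (use F in \<open>cases b; auto\<close>)
        have "coord F (x, b, s) = 0" if "x \<notin> carrier G \<or> s \<notin> {i + 1..int n}" for x b s
        proof (cases "x \<in> carrier G \<and> s = i")
          case False
          then have "x \<notin> carrier G \<or> (b, s) \<notin> UNIV \<times> {i..int n}" using that by auto
          then show ?thesis using F unfolding W_def supported_def by blast
        qed (use z in auto)
        then show "F \<in> W (i + 1)" using F by (auto simp: W_def supported_def)
      qed
    qed
    ultimately show ?thesis using vdim_le_entry[OF W[OF i(1)] P idx[OF i], of False] by linarith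
  qed
  have W0: "real n + 1 - real d \<le> vdim (W 0)"
  proof -
    let ?V = "supported (UNIV \<times> {0..int n})" and ?U = "supported ({False} \<times> {0..D})"
    have U: "{False} \<times> {0..D} \<subseteq> I" by (auto simp: I_def)
    have "vdim ?V \<le> vdim {F \<in> ?V. T F = 0} + vdim ?U"
      by (rule vdim_le_kernel_plus_range[OF supported_kernels[OF sub] supported_kernels[OF U] T])
        (auto simp: supported_def coord_T)
    moreover have "{F \<in> ?V. T F = 0} = W 0" by (auto simp: W_def)
    moreover have "vdim ?V = 2 * (real n + 1)"
      by (simp add: vdim_supported[OF sub] card_cartesian_product)
    moreover have "vdim ?U = real n + real d + 1"
      using vdim_supported[OF U] by (simp add: card_cartesian_product D_def)
    ultimately show ?thesis by simp
  qed
  have Wn: "vdim (W (int n + 1)) \<le> 0"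
  proof -
    have "vdim (W (int n + 1)) \<le> vdim (supported {})"
      by (rule vdim_mono[OF W supported_kernels]) (auto simp: W_def supported_def)
    then show ?thesis using vdim_supported[of "{}"] by simp
  qed
  have "\<exists>i P. 0 \<le> i \<and> i \<le> int n \<and> P \<in> M \<and> is_proj P (W i) \<and>
      nullity (entry P (False, i) (False, i)) < \<nu> + \<epsilon>"
  proof (rule ccontr)
    assume contra: "\<not> ?thesis"
    have drop: "vdim (W i) \<le> vdim (W (i + 1)) + (1 - \<epsilon>)" if i: "0 \<le> i" "i \<le> int n" for i
    proof -
      obtain P where P: "P \<in> M" "is_proj P (W i)" using kernels_proj[OF W[OF i(1)]] by blast
      then have "\<not> nullity (entry P (False, i) (False, i)) < \<nu> + \<epsilon>" using contra i by blast
      then show ?thesis using step[OF i P] by linarith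
    qed
    have "vdim (W 0) \<le> vdim (W (int k)) + real k * (1 - \<epsilon>)" if "k \<le> n + 1" for k
      using that
    proof (induction k)
      case (Suc k)
      then have "vdim (W 0) \<le> vdim (W (int k)) + real k * (1 - \<epsilon>)" by simp
      moreover have "vdim (W (int k)) \<le> vdim (W (int (Suc k))) + (1 - \<epsilon>)"
        using drop[of "int k"] Suc.prems by (simp add: add.commute)
      ultimately show ?case by (simp add: algebra_simps)
    qed simp
    from this[of "n + 1"] have "vdim (W 0) \<le> vdim (W (int n + 1)) + (real n + 1) * (1 - \<epsilon>)"
      by (simp add: add.commute)
    then show False using W0 Wn n by (simp add: algebra_simps)
  qed
  then obtain i P where i: "0 \<le> i" "i \<le> int n" and P: "P \<in> M" "is_proj P (W i)"
    and small: "nullity (entry P (False, i) (False, i)) < \<nu> + \<epsilon>" by blast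
  \<comment> \<open>The column of \<open>P\<close> belonging to the unknown \<open>x\<^sub>i\<close> solves the system, because \<open>P\<close> maps into \<open>W i\<close>.\<close>
  define col where "col b s = (if s \<in> {i..int n} then entry P (b, s) (False, i) else (\<lambda>f x. 0))" for b s
  have col: "col b s \<in> carrier (group_vN G)" for b s
  proof (cases "s \<in> {i..int n}")
    case True
    then have "(b, s) \<in> I" "(False, i) \<in> I" using i idx by auto
    then show ?thesis using True entry_carrier[OF P(1)] by (simp add: col_def)
  next
    case False
    then show ?thesis using group_vN_zero by (auto simp: col_def)
  qed
  have col_outside: "col b s = (\<lambda>f x. 0)" if "s \<notin> {i..int n}" for b s
    using that unfolding col_def by (rule if_not_P)
  have eq: "(\<Sum>s\<in>{i..int n}. c m s (col False s f) z) = (\<Sum>s\<in>{i..int n}. c' m s (col True s f) z)" for m f z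
  proof (cases "f \<in> ell2 (carrier G)")
    case True
    \<comment> \<open>The column applied to \<open>f\<close> is a solution vector in \<open>\<ell>\<^sup>2\<close>, so the rows of the system hold for it.\<close>
    define F where "F = P (up (False, i) (Abs_l2 f))"
    have F: "F \<in> W i" unfolding F_def by (rule is_projD(1)[OF P(2)])
    have outside: "coord (down (b, s) F) = (\<lambda>x. 0)" if "s < i" for b s
      by (rule down_supported[of F "UNIV \<times> {i..int n}"]) (use F that in \<open>auto simp: W_def\<close>)
    have col_f: "col b s f = coord (down (b, s) F)" if "s \<in> {i..int n}" for b s
      using that by (simp add: col_def entry_apply[OF True] F_def)
    have "(\<Sum>s\<in>{i..int n}. c m s (col False s f) z) = (\<Sum>s\<in>{0..int n}. c m s (coord (down (False, s) F)) z)"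
      using i by (intro sum.mono_neutral_cong_left) (auto simp: col_f outside group_vN_at_zero[OF c])
    moreover have "(\<Sum>s\<in>{i..int n}. c' m s (col True s f) z) = (\<Sum>s\<in>{0..int n}. c' m s (coord (down (True, s) F)) z)"
      using i by (intro sum.mono_neutral_cong_left) (auto simp: col_f outside group_vN_at_zero[OF c'])
    ultimately show ?thesis using row[OF F, of m z] by simp
  next
    case False
    then show ?thesis
      by (simp add: group_vN_carrierD(4)[OF col] group_vN_at_zero[OF c] group_vN_at_zero[OF c'])
  qed
  show ?thesis
  proof (intro exI conjI allI impI)
    show "i \<le> int n" by (rule i)
    show "nullity (col False i) < \<nu> + \<epsilon>" using small i by (simp add: col_def)
    show "(\<Sum>s\<in>{i..int n}. c m s (col False s f) z) = (\<Sum>s\<in>{i..int n}. c' m s (col True s f) z)" for m f z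
      by (rule eq)
    show "col False s = (\<lambda>f x. 0)" if "s \<notin> {i..int n}" for s by (rule col_outside[OF that])
    show "col True s = (\<lambda>f x. 0)" if "s \<notin> {i..int n}" for s by (rule col_outside[OF that])
  qed (rule col)+
qed

lemma (in group) nullity_le_of_comp_eq:
  assumes a: "a \<in> carrier (group_vN G)" and b: "b \<in> carrier (group_vN G)"
    and a': "a' \<in> carrier (group_vN G)" and b': "b' \<in> carrier (group_vN G)"
    and eq: "a \<circ> b = a' \<circ> b'"
  defines "nul \<equiv> \<lambda>a. vN_dim G (ell2_kernel (carrier G) a)"
  shows "nul b' \<le> nul a + nul b"
proof -
  interpret l2_copies G "{()}" by standard simp
  show ?thesis
    using nullity_comp(1)[OF a' b', of "()"] nullity_comp(2)[OF a b, of "()"] eq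
    by (simp add: nul_def)
qed

text \<open>
  A product with a polynomial shifted by \<open>k\<close>, written as one row of a linear system.
\<close>

lemma (in group) twisted_product:
  assumes p: "p \<in> carrier (twisted_laurent (group_vN G) \<alpha>)"
    and x: "\<And>s. x s \<in> carrier (group_vN G)" and supp: "\<And>s. s \<notin> {i..n} \<Longrightarrow> x s = (\<lambda>f z. 0)"
    and \<alpha>: "\<And>j a. a \<in> carrier (group_vN G) \<Longrightarrow> \<alpha> j a \<in> carrier (group_vN G)"
    and \<alpha>0: "\<And>j. \<alpha> j (\<lambda>f z. 0) = (\<lambda>f z. 0)"
  shows "(p \<otimes>\<^bsub>twisted_laurent (group_vN G) \<alpha>\<^esub> (\<lambda>j. x (j + k))) m =
    (\<lambda>f z. \<Sum>s\<in>{i..n}. \<alpha> (- (s - k)) (p (m - s + k)) (x s f) z)"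
proof -
  let ?R = "group_vN G"
  have z: "\<zero>\<^bsub>?R\<^esub> = (\<lambda>f x. 0)" and mult: "a \<otimes>\<^bsub>?R\<^esub> b = a \<circ> b" for a b
    by (simp_all add: group_vN_def)
  have pR: "p l \<in> carrier ?R" for l using p by (simp add: twisted_laurent_def)
  have fin: "finite {l. p l \<noteq> \<zero>\<^bsub>?R\<^esub>}" using p by (simp add: twisted_laurent_def)
  have "(p \<otimes>\<^bsub>twisted_laurent ?R \<alpha>\<^esub> (\<lambda>j. x (j + k))) m =
      finsum ?R (\<lambda>l. \<alpha> (- (m - l)) (p l) \<circ> x (m - l + k)) {l. p l \<noteq> \<zero>\<^bsub>?R\<^esub>}"
    by (simp add: twisted_laurent_def mult)
  also have "\<dots> = (\<lambda>f z. \<Sum>l | p l \<noteq> \<zero>\<^bsub>?R\<^esub>. \<alpha> (- (m - l)) (p l) (x (m - l + k) f) z)"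
    by (subst group_vN_finsum[OF fin]) (auto intro: group_vN_comp \<alpha> pR x)
  also have "\<dots> = (\<lambda>f z. \<Sum>s\<in>{i..n}. \<alpha> (- (s - k)) (p (m - s + k)) (x s f) z)"
  proof (intro ext)
    fix f z
    define g where "g l = \<alpha> (- (m - l)) (p l) (x (m - l + k) f) z" for l
    have g0: "g l = 0" if "p l = \<zero>\<^bsub>?R\<^esub> \<or> m - l + k \<notin> {i..n}" for l
      using that by (auto simp: g_def z \<alpha>0 supp group_vN_at_zero[OF \<alpha>[OF pR]])
    \<comment> \<open>A term vanishes unless \<open>p l \<noteq> 0\<close> and the index of \<open>x\<close> lies in \<open>{i..n}\<close>, so both sums
      reduce to the common part of their index sets.\<close>
    have "(\<Sum>l | p l \<noteq> \<zero>\<^bsub>?R\<^esub>. g l) = (\<Sum>l\<in>{l. p l \<noteq> \<zero>\<^bsub>?R\<^esub>} \<inter> {m + k - n..m + k - i}. g l)"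
      by (rule sum.mono_neutral_right[OF fin]) (auto intro!: g0)
    also have "\<dots> = (\<Sum>l\<in>{m + k - n..m + k - i}. g l)"
      by (rule sum.mono_neutral_left) (auto intro!: g0)
    also have "\<dots> = (\<Sum>s\<in>{i..n}. \<alpha> (- (s - k)) (p (m - s + k)) (x s f) z)"
      by (rule sum.reindex_bij_witness[of _ "\<lambda>s. m + k - s" "\<lambda>l. m + k - l"])
        (auto simp: g_def algebra_simps)
    finally show "(\<Sum>l | p l \<noteq> \<zero>\<^bsub>?R\<^esub>. \<alpha> (- (m - l)) (p l) (x (m - l + k) f) z) =
        (\<Sum>s\<in>{i..n}. \<alpha> (- (s - k)) (p (m - s + k)) (x s f) z)" unfolding g_def .
  qed
  finally show ?thesis .
qed

text \<open>
  Shifting both polynomials by their lowest exponents \<open>k\<close> and \<open>k'\<close> turns the equation into a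
  triangular system. Its solution starts in a degree \<open>i\<close> where \<open>r\<close> has small nullity, and the \<open>i\<close>-th
  equation bounds the nullity of \<open>r'\<close> by \<open>nullity_le_of_comp_eq\<close>.
\<close>

lemma (in normal) laurent_common_multiple:
  assumes g: "\<And>j. g j \<in> carrier G"
    and q: "q \<in> carrier (twisted_laurent (group_vN K) (\<lambda>j. vN_conj G H (g j)))"
    and q': "q' \<in> carrier (twisted_laurent (group_vN K) (\<lambda>j. vN_conj G H (g j)))"
    and "\<epsilon> > 0"
  defines "nul \<equiv> \<lambda>x. vN_dim K (ell2_kernel H (pure_part (group_vN K) (laurent_init (group_vN K) x)))"
  shows "\<exists>r \<in> carrier (twisted_laurent (group_vN K) (\<lambda>j. vN_conj G H (g j))). \<exists>r' \<in> carrier (twisted_laurent (group_vN K) (\<lambda>j. vN_conj G H (g j))).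
    nul r < nul q' + \<epsilon> \<and> nul r' < nul q + nul q' + \<epsilon> \<and>
    q \<otimes>\<^bsub>twisted_laurent (group_vN K) (\<lambda>j. vN_conj G H (g j))\<^esub> r = q' \<otimes>\<^bsub>twisted_laurent (group_vN K) (\<lambda>j. vN_conj G H (g j))\<^esub> r'"
proof -
  interpret K: group K by (rule K_group)
  let ?L = "twisted_laurent (group_vN K) (\<lambda>j. vN_conj G H (g j))"
  let ?R = "group_vN K" and ?\<alpha> = "\<lambda>j. vN_conj G H (g j)"
  let ?null = "\<lambda>a. vN_dim K (ell2_kernel H a)"
  have z: "\<zero>\<^bsub>?R\<^esub> = (\<lambda>f x. 0)" by (simp add: group_vN_def)
  have coeff: "p l \<in> carrier ?R" and fin: "finite {l. p l \<noteq> \<zero>\<^bsub>?R\<^esub>}" if "p \<in> carrier ?L" for p l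
    using that by (simp_all add: twisted_laurent_def)
  have \<alpha>: "?\<alpha> j a \<in> carrier ?R" if "a \<in> carrier ?R" for j a by (rule vN_conj_carrier[OF that g])
  obtain k where k: "\<forall>j<k. q j = (\<lambda>f x. 0)" "nul q = ?null (q k)"
    using K.nullity_initial(1)[OF q] by (auto simp: nul_def)
  obtain k' where k': "\<forall>j<k'. q' j = (\<lambda>f x. 0)" "nul q' = ?null (q' k')"
    using K.nullity_initial(1)[OF q'] by (auto simp: nul_def)
  have top: "\<exists>d::nat. \<forall>l>k + int d. p l = (\<lambda>f x. 0)" if pL: "p \<in> carrier ?L" for p k
  proof -
    obtain u where u: "\<And>l. l \<in> {l. p l \<noteq> \<zero>\<^bsub>?R\<^esub>} \<Longrightarrow> l \<le> u"
      using bdd_above_finite[OF fin[OF pL]] unfolding bdd_above_def by blast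
    have "p l = (\<lambda>f x. 0)" if "l > k + int (nat (u - k))" for l
    proof -
      have "\<not> l \<le> u" using that by linarith
      then show ?thesis using u[of l] by (auto simp: z)
    qed
    then show ?thesis by blast
  qed
  obtain d1 d2 where d1: "\<forall>l>k + int d1. q l = (\<lambda>f x. 0)" and d2: "\<forall>l>k' + int d2. q' l = (\<lambda>f x. 0)"
    using top[OF q, of k] top[OF q', of k'] by blast
  define c where "c m s = ?\<alpha> (- (s - k)) (q (m - s + k))" for m s
  define c' where "c' m s = ?\<alpha> (- (s - k')) (q' (m - s + k'))" for m s
  have cR: "c m s \<in> carrier ?R" "c' m s \<in> carrier ?R" for m s
    unfolding c_def c'_def by (rule \<alpha>, rule coeff, fact)+
  have "\<exists>i n x y. i \<le> n \<and> (\<forall>s. x s \<in> carrier ?R \<and> y s \<in> carrier ?R) \<and>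
    (\<forall>s. s \<notin> {i..n} \<longrightarrow> x s = (\<lambda>f x. 0) \<and> y s = (\<lambda>f x. 0)) \<and>
    vN_dim K (ell2_kernel (carrier K) (x i)) < nul q' + \<epsilon> \<and>
    (\<forall>m f z. (\<Sum>s\<in>{i..n}. c m s (x s f) z) = (\<Sum>s\<in>{i..n}. c' m s (y s f) z))"
  proof (rule K.triangular_system_solution[where d = "d1 + d2"])
    show "c m s = (\<lambda>f x. 0) \<and> c' m s = (\<lambda>f x. 0)" if "m < s" for m s
      using that k(1) k'(1) by (simp add: c_def c'_def vN_conj_zero[OF g])
    show "c m s = (\<lambda>f x. 0) \<and> c' m s = (\<lambda>f x. 0)" if "s + int (d1 + d2) < m" for m s
      using that d1 d2 by (simp add: c_def c'_def vN_conj_zero[OF g])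
    show "vN_dim K (ell2_kernel (carrier K) (c' s s)) = nul q'" for s
      using vN_conj_nullity[OF coeff[OF q'] g] by (simp add: c'_def k'(2))
  qed (fact cR \<open>\<epsilon> > 0\<close>)+
  then obtain i n x y where "i \<le> n"
    and xy: "\<forall>s. x s \<in> carrier ?R \<and> y s \<in> carrier ?R"
    and supp: "\<forall>s. s \<notin> {i..n} \<longrightarrow> x s = (\<lambda>f x. 0) \<and> y s = (\<lambda>f x. 0)"
    and small': "vN_dim K (ell2_kernel (carrier K) (x i)) < nul q' + \<epsilon>"
    and sys: "\<forall>m f z. (\<Sum>s\<in>{i..n}. c m s (x s f) z) = (\<Sum>s\<in>{i..n}. c' m s (y s f) z)"
    by blast
  have xR: "x s \<in> carrier ?R" and yR: "y s \<in> carrier ?R" for s using xy by auto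
  have out: "x s = (\<lambda>f x. 0)" "y s = (\<lambda>f x. 0)" if "s \<notin> {i..n}" for s
    using supp that by blast+
  have small: "?null (x i) < nul q' + \<epsilon>" using small' by simp
  have eq: "(\<Sum>s\<in>{i..n}. c m s (x s f) z) = (\<Sum>s\<in>{i..n}. c' m s (y s f) z)" for m f z
    using sys by blast
  define r where "r j = x (j + k)" for j
  define r' where "r' j = y (j + k')" for j
  have shift: "(\<lambda>j. w (j + l)) \<in> carrier ?L"
    if "\<And>s. w s \<in> carrier ?R" "\<And>s. s \<notin> {i..n} \<Longrightarrow> w s = (\<lambda>f x. 0)" for w and l :: int
  proof -
    have "{j. w (j + l) \<noteq> \<zero>\<^bsub>?R\<^esub>} \<subseteq> {i - l..n - l}"
      using that(2) by (force simp: z)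
    then show ?thesis using that(1) by (simp add: twisted_laurent_def finite_subset)
  qed
  have rL: "r \<in> carrier ?L" and r'L: "r' \<in> carrier ?L"
    unfolding r_def r'_def by (rule shift; fact)+
  have "nul r \<le> ?null (r (i - k))"
    using K.nullity_initial(2)[OF rL, of "i - k"] out(1) by (simp add: nul_def r_def)
  then have nr: "nul r < nul q' + \<epsilon>" using small by (simp add: r_def)
  have "c i i \<circ> x i = c' i i \<circ> y i"
  proof (intro ext)
    fix f z
    have "(\<Sum>s\<in>{i..n}. c i s (x s f) z) = c i i (x i f) z"
      using \<open>i \<le> n\<close> k(1) by (subst sum.mono_neutral_right[of _ "{i}"])
        (auto simp: c_def vN_conj_zero[OF g])
    moreover have "(\<Sum>s\<in>{i..n}. c' i s (y s f) z) = c' i i (y i f) z"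
      using \<open>i \<le> n\<close> k'(1) by (subst sum.mono_neutral_right[of _ "{i}"])
        (auto simp: c'_def vN_conj_zero[OF g])
    ultimately show "(c i i \<circ> x i) f z = (c' i i \<circ> y i) f z" using eq[of i f z] by simp
  qed
  then have "?null (y i) \<le> ?null (c i i) + ?null (x i)"
    using K.nullity_le_of_comp_eq[OF cR(1) xR cR(2) yR] by simp
  also have "?null (c i i) = nul q"
    using vN_conj_nullity[OF coeff[OF q] g] by (simp add: c_def k(2))
  finally have "?null (y i) < nul q + nul q' + \<epsilon>" using small by linarith
  moreover have "nul r' \<le> ?null (r' (i - k'))"
    using K.nullity_initial(2)[OF r'L, of "i - k'"] out(2) by (simp add: nul_def r'_def)
  ultimately have nr': "nul r' < nul q + nul q' + \<epsilon>" by (simp add: r'_def)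
  have "q \<otimes>\<^bsub>?L\<^esub> r = q' \<otimes>\<^bsub>?L\<^esub> r'"
  proof
    fix m
    have "(q \<otimes>\<^bsub>?L\<^esub> r) m = (\<lambda>f z. \<Sum>s\<in>{i..n}. c m s (x s f) z)"
      unfolding r_def[abs_def] c_def
      by (rule K.twisted_product[OF q xR out(1) \<alpha> vN_conj_zero[OF g]])
    also have "\<dots> = (\<lambda>f z. \<Sum>s\<in>{i..n}. c' m s (y s f) z)" by (simp only: eq)
    also have "\<dots> = (q' \<otimes>\<^bsub>?L\<^esub> r') m"
      unfolding r'_def[abs_def] c'_def
      by (rule K.twisted_product[OF q' yR out(2) \<alpha> vN_conj_zero[OF g], symmetric])
    finally show "(q \<otimes>\<^bsub>?L\<^esub> r) m = (q' \<otimes>\<^bsub>?L\<^esub> r') m" .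
  qed
  then show ?thesis using rL r'L nr nr' by blast
qed

theorem proposition4p6:
  fixes G :: "('a, 'b) monoid_scheme"
    and \<phi> :: "'a \<Rightarrow> int"
    and t :: 'a
    and q q' :: "int \<Rightarrow> 'a vec_op"
    and \<epsilon> :: real
  assumes "group G"
    and "countable (carrier G)"
    and "\<phi> \<in> epi G integer_group"
    and "t \<in> carrier G"
    and "generate integer_group {\<phi> t} = carrier integer_group"
    and "q \<in> carrier (vN_laurent G \<phi> t)"
    and "q' \<in> carrier (vN_laurent G \<phi> t)"
    and "\<epsilon> > 0"
  shows "\<exists>r \<in> carrier (vN_laurent G \<phi> t). \<exists>r' \<in> carrier (vN_laurent G \<phi> t).
           vN_nullity G \<phi> r < vN_nullity G \<phi> q' + \<epsilon> \<and>
           vN_nullity G \<phi> r' < vN_nullity G \<phi> q + vN_nullity G \<phi> q' + \<epsilon> \<and>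
           q \<otimes>\<^bsub>vN_laurent G \<phi> t\<^esub> r = q' \<otimes>\<^bsub>vN_laurent G \<phi> t\<^esub> r'"
proof -
  interpret G: group G by fact
  have "group_hom G integer_group \<phi>"
    using assms(3) G.is_group by (auto simp: group_hom_def group_hom_axioms_def epi_def)
  then interpret normal "kernel G integer_group \<phi>" G by (rule group_hom.normal_kernel)
  have "t [^]\<^bsub>G\<^esub> j \<in> carrier G" for j :: int using assms(4) by simp
  from laurent_common_multiple[OF this assms(6)[unfolded vN_laurent_def]
      assms(7)[unfolded vN_laurent_def] assms(8)]
  show ?thesis by (simp add: vN_laurent_def vN_nullity_def Let_def)
qed

end
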